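(* The singular locus $\mathrm{sing}(L_{2,4})$ is the union of $60$ three-dimensional linear subspaces of $\mathbb C^6$, of three types: Type I (32 subspaces, whose union is $L_{1,4}$): for each choice of $s_{13},s_{23},s_{14},s_{24},s_{34}\in\{1,-1\}$, the subspace defined by $l_{12}-s_{13}l_{13}+s_{23}l_{23}=0$, $l_{12}-s_{14}l_{14}+s_{24}l_{24}=0$, $s_{13}l_{13}-s_{14}l_{14}+s_{34}l_{34}=0$. Type II (24 subspaces): for each edge $\{a,b\}$ of $K_4$, with $\{c,e\}$ the other two vertices, and each choice of signs $\epsilon_1,\epsilon_2\in\{1,-1\}$, the subspace defined by $l_{ab}=0$, $l_{ac}=\epsilon_1 l_{bc}$, $l_{ae}=\epsilon_2 l_{be}$ (e.g., for $\{1,2\}$: $l_{12}=0$, $l_{13}=s_{23}l_{23}$, $l_{14}=s_{24}l_{24}$). Type III (4 subspaces): for each triangle $\{a,b,c\}$ of $K_4$, the subspace defined by $l_{ab}=l_{ac}=l_{bc}=0$.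
   Context: Coordinates of $\mathbb C^6$ are $l_{ij}$ indexed by the edges $\{i,j\}$ of $K_4$ (write $l_{ij}=l_{ji}$). $L_{2,4}\subset\mathbb C^6$ is the hypersurface defined by the vanishing of the determinant of the symmetric $3\times3$ matrix with diagonal entries $2l_{14}^2,2l_{24}^2,2l_{34}^2$ and off-diagonal entries $(1,2)$: $l_{14}^2+l_{24}^2-l_{12}^2$, $(1,3)$: $l_{14}^2+l_{34}^2-l_{13}^2$, $(2,3)$: $l_{24}^2+l_{34}^2-l_{23}^2$; equivalently, it is the set of $l$ whose coordinatewise square is a vector of squared distances $\sum_{k=1}^2({\bf p}_i^k-{\bf p}_j^k)^2$ of some complex configuration of 4 points in $\mathbb C^2$. $L_{1,4}\subset\mathbb C^6$ is the analogous set for configurations of 4 points in $\mathbb C^1$. A point is singular if the dimension of the Zariski tangent space exceeds the local dimension. *)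

theory Defs
  imports "HOL-Analysis.Analysis"
begin

definition edge_idx :: "nat \<Rightarrow> nat \<Rightarrow> 6" where
  "edge_idx i j = (let a = min i j; b = max i j in
      if (a,b) = (1,2) then 1 else if (a,b) = (1,3) then 2 else if (a,b) = (1,4) then 3
      else if (a,b) = (2,3) then 4 else if (a,b) = (2,4) then 5 else 6)"

definition coord :: "complex ^ 6 \<Rightarrow> nat \<Rightarrow> nat \<Rightarrow> complex" where
  "coord l i j = l $ edge_idx i j"

definition CM_matrix :: "complex ^ 6 \<Rightarrow> complex ^ 3 ^ 3" where
  "CM_matrix l = (let d = (\<lambda>k. (coord l k 4)\<^sup>2); e = (\<lambda>i j. (coord l i j)\<^sup>2) in
     vector [vector [2 * d 1, d 1 + d 2 - e 1 2, d 1 + d 3 - e 1 3],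
             vector [d 1 + d 2 - e 1 2, 2 * d 2, d 2 + d 3 - e 2 3],
             vector [d 1 + d 3 - e 1 3, d 2 + d 3 - e 2 3, 2 * d 3]])"

definition L24 :: "(complex ^ 6) set" where
  "L24 = {l. det (CM_matrix l) = 0}"

definition L14 :: "(complex ^ 6) set" where
  "L14 = {l. \<exists>p :: nat \<Rightarrow> complex. \<forall>i j. 1 \<le> i \<longrightarrow> i < j \<longrightarrow> j \<le> 4 \<longrightarrow>
              (coord l i j)\<^sup>2 = (p i - p j)\<^sup>2}"

inductive_set poly_fun :: "(complex ^ 6 \<Rightarrow> complex) set" where
  const: "(\<lambda>x. c) \<in> poly_fun"
| var: "(\<lambda>x. x $ i) \<in> poly_fun"
| add: "f \<in> poly_fun \<Longrightarrow> g \<in> poly_fun \<Longrightarrow> (\<lambda>x. f x + g x) \<in> poly_fun"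
| mult: "f \<in> poly_fun \<Longrightarrow> g \<in> poly_fun \<Longrightarrow> (\<lambda>x. f x * g x) \<in> poly_fun"

definition vanishing_ideal :: "(complex ^ 6) set \<Rightarrow> (complex ^ 6 \<Rightarrow> complex) set" where
  "vanishing_ideal X = {g \<in> poly_fun. \<forall>x\<in>X. g x = 0}"

definition zariski_closed :: "(complex ^ 6) set \<Rightarrow> bool" where
  "zariski_closed S \<longleftrightarrow> (\<exists>F \<subseteq> poly_fun. S = {x. \<forall>f\<in>F. f x = 0})"

definition irreducible_closed :: "(complex ^ 6) set \<Rightarrow> bool" where
  "irreducible_closed Z \<longleftrightarrow> zariski_closed Z \<and> Z \<noteq> {} \<and>
     (\<forall>A B. zariski_closed A \<longrightarrow> zariski_closed B \<longrightarrow> Z \<subseteq> A \<union> B \<longrightarrow> Z \<subseteq> A \<or> Z \<subseteq> B)"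

text \<open>Local dimension of X at p: the largest n such that there is a chain
  Z_0 < Z_1 < ... < Z_n of irreducible closed sets with Z_n contained in X and p in Z_n
  (= maximal dimension of an irreducible component of X through p).\<close>
definition local_dim :: "(complex ^ 6) set \<Rightarrow> complex ^ 6 \<Rightarrow> nat" where
  "local_dim X p = Sup {n. \<exists>c :: nat \<Rightarrow> (complex ^ 6) set.
      (\<forall>i\<le>n. irreducible_closed (c i)) \<and> (\<forall>i<n. c i \<subset> c (Suc i)) \<and> c n \<subseteq> X \<and> p \<in> c n}"

definition zariski_tangent :: "(complex ^ 6) set \<Rightarrow> complex ^ 6 \<Rightarrow> (complex ^ 6) set" where
  "zariski_tangent X p = {v. \<forall>g\<in>vanishing_ideal X. deriv (\<lambda>t::complex. g (p + t *s v)) 0 = 0}"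

definition singular_point :: "(complex ^ 6) set \<Rightarrow> complex ^ 6 \<Rightarrow> bool" where
  "singular_point X p \<longleftrightarrow> p \<in> X \<and> vec.dim (zariski_tangent X p) > local_dim X p"

definition sing :: "(complex ^ 6) set \<Rightarrow> (complex ^ 6) set" where
  "sing X = {p. singular_point X p}"

definition typeI :: "(complex ^ 6) set set" where
  "typeI = {V. \<exists>s13 s23 s14 s24 s34. {s13,s23,s14,s24,s34} \<subseteq> {1,-1} \<and>
     V = {l. coord l 1 2 - s13 * coord l 1 3 + s23 * coord l 2 3 = 0
           \<and> coord l 1 2 - s14 * coord l 1 4 + s24 * coord l 2 4 = 0
           \<and> s13 * coord l 1 3 - s14 * coord l 1 4 + s34 * coord l 3 4 = 0}}"

definition typeII :: "(complex ^ 6) set set" where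
  "typeII = {V. \<exists>a b c e \<epsilon>1 \<epsilon>2. {a,b,c,e} = {1,2,3,4::nat} \<and> {\<epsilon>1,\<epsilon>2} \<subseteq> {1,-1} \<and>
     V = {l. coord l a b = 0 \<and> coord l a c = \<epsilon>1 * coord l b c \<and> coord l a e = \<epsilon>2 * coord l b e}}"

definition typeIII :: "(complex ^ 6) set set" where
  "typeIII = {V. \<exists>a b c. {a,b,c} \<subseteq> {1,2,3,4::nat} \<and> card {a,b,c} = 3 \<and>
     V = {l. coord l a b = 0 \<and> coord l a c = 0 \<and> coord l b c = 0}}"

end

theory Submission
  imports Defs "HOL-Computational_Algebra.Polynomial" "HOL-Library.Function_Algebras"
begin

text \<open>
  As a polynomial in the last coordinate \<open>y\<close> the determinant is \<open>A y\<^sup>4 + B y\<^sup>2 + C\<close> with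
  \<open>A = -2 l\<^sub>1\<^sub>2\<^sup>2\<close> and with four distinct roots for generic values of the other coordinates. Division
  by it, up to powers of \<open>A\<close>, shows that it generates the vanishing ideal of \<open>L24\<close>. Neither the
  discriminant \<open>B\<^sup>2 - 4 A C\<close> nor \<open>A C\<close> is a square, so a norm argument shows that \<open>L24\<close> is
  irreducible.

  In a chain \<open>Z\<^sub>0 \<subset> \<dots> \<subset> Z\<^sub>n\<close> of irreducible closed sets, polynomials vanishing on \<open>Z\<^sub>i\<close> but not on
  \<open>Z\<^sub>i\<^sub>+\<^sub>1\<close> are algebraically independent on \<open>Z\<^sub>n\<close>; counting monomials gives \<open>n \<le> 6\<close>. Together with
  an explicit chain of length five this makes the local dimension of \<open>L24\<close> equal to 5 everywhere, so
  the singular points are exactly the critical points of the determinant. If no coordinate vanishes,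
  being critical says that all 2 by 2 minors of the Gram matrix vanish, that is, that the points are
  collinear; if one coordinate vanishes, the critical equations factor and yield types II and III.
\<close>

text \<open>Let y be the last coordinate, z = y^2, and K the field of rational functions in the
  other five. The quartic describes a tower: z is quadratic over K, then y^2 = z. It can factor only
  if z lies in K, which makes the discriminant a square, or if z is a square in K(z); then its norm
  C / A is a square in K. These are the origins of the two non-squares. Since A is -2 times a
  square, the second one becomes a statement about -2 C. No fraction field is formed. Each division
  is replaced by multiplication by a power of A, which is undone at the end because l12 does not
  divide the determinant; identities proved where some polynomial is nonzero are extended everywhere
  by density. The local dimension is a supremum of naturals, so its value rests on a uniform bound
  for chain lengths. Its definition asks only the top member of a chain to contain the point, so one
  chain ending in \<open>L24\<close> serves all points.\<close>

lemma exhaust_6: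
  fixes x :: 6
  shows "x = 1 \<or> x = 2 \<or> x = 3 \<or> x = 4 \<or> x = 5 \<or> x = 6"
proof (induct x)
  case (of_int z)
  then have "0 \<le> z" "z < 6" by simp_all
  then have "z = 0 \<or> z = 1 \<or> z = 2 \<or> z = 3 \<or> z = 4 \<or> z = 5" by arith
  then show ?case by auto
qed

lemma UNIV_6: "(UNIV :: 6 set) = {1, 2, 3, 4, 5, 6}"
  using exhaust_6 by auto

lemma forall_6: "(\<forall>i::6. P i) \<longleftrightarrow> P 1 \<and> P 2 \<and> P 3 \<and> P 4 \<and> P 5 \<and> P 6"
  using exhaust_6 by (intro iffI allI; metis)

lemma sum_6: "(\<Sum>i\<in>(UNIV::6 set). f i) = f 1 + f 2 + f 3 + f 4 + f 5 + (f 6 :: 'a :: comm_monoid_add)"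
  unfolding UNIV_6 by (simp add: ac_simps)

lemma coord_simps:
  "coord l 1 2 = l $ 1" "coord l 1 3 = l $ 2" "coord l 1 4 = l $ 3"
  "coord l 2 3 = l $ 4" "coord l 2 4 = l $ 5" "coord l 3 4 = l $ 6"
  "coord l 2 1 = l $ 1" "coord l 3 1 = l $ 2" "coord l 4 1 = l $ 3"
  "coord l 3 2 = l $ 4" "coord l 4 2 = l $ 5" "coord l 4 3 = l $ 6"
  by (simp_all add: coord_def edge_idx_def)

section \<open>Polynomial functions\<close>

lemma poly_fun_power: "f \<in> poly_fun \<Longrightarrow> (\<lambda>x. f x ^ n) \<in> poly_fun"
  by (induction n) (auto intro: poly_fun.intros)

lemma poly_fun_uminus: "f \<in> poly_fun \<Longrightarrow> (\<lambda>x. - f x) \<in> poly_fun"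
  using poly_fun.mult[OF poly_fun.const[of "-1"]] by simp

lemma poly_fun_diff: "f \<in> poly_fun \<Longrightarrow> g \<in> poly_fun \<Longrightarrow> (\<lambda>x. f x - g x) \<in> poly_fun"
  using poly_fun.add[OF _ poly_fun_uminus] by simp

lemma poly_fun_sum:
  assumes "\<And>i. i \<in> I \<Longrightarrow> f i \<in> poly_fun"
  shows "(\<lambda>x. \<Sum>i\<in>I. f i x) \<in> poly_fun"
  using assms by (induction I rule: infinite_finite_induct) (auto intro: poly_fun.intros)

lemmas poly_fun_intros = poly_fun.intros poly_fun_power poly_fun_uminus poly_fun_diff
  poly_fun_sum

lemma poly_fun_compose:
  assumes "f \<in> poly_fun" and "\<And>i. (\<lambda>x. \<phi> x $ i) \<in> poly_fun"
  shows "(\<lambda>x. f (\<phi> x)) \<in> poly_fun"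
  using assms(1) by induction (auto intro: poly_fun.intros assms(2))

text \<open>Polynomial functions are only a generated set of functions. Restricting them to lines
  reaches univariate \<open>poly\<close>, where roots and orders of vanishing are available.\<close>

lemma poly_fun_on_line:
  assumes "f \<in> poly_fun"
  shows "\<exists>P. \<forall>t. f (p + t *s v) = poly P t"
  using assms
proof induction
  case (const c)
  have "\<forall>t. c = poly [:c:] t" by simp
  then show ?case by blast
next
  case (var i)
  have "\<forall>t. (p + t *s v) $ i = poly [:p $ i, v $ i:] t" by (simp add: algebra_simps)
  then show ?case by blast
next
  case (add f g)
  then show ?case by (metis poly_add)
next
  case (mult f g)
  then show ?case by (metis poly_mult)
qed

text \<open>A line through a nonzero of \<open>f\<close> and a nonzero of \<open>g\<close> restricts
  both to nonzero univariate polynomials, whose product is nonzero.\<close>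

lemma poly_fun_domain:
  assumes f: "f \<in> poly_fun" and g: "g \<in> poly_fun" and fg: "\<And>x. f x * g x = 0"
  shows "(\<forall>x. f x = 0) \<or> (\<forall>x. g x = 0)"
proof (rule ccontr)
  assume "\<not> ?thesis"
  then obtain x y where x: "f x \<noteq> 0" and y: "g y \<noteq> 0" by blast
  obtain P where P: "\<And>t. f (x + t *s (y - x)) = poly P t"
    using poly_fun_on_line[OF f] by blast
  obtain Q where Q: "\<And>t. g (x + t *s (y - x)) = poly Q t"
    using poly_fun_on_line[OF g] by blast
  have "poly (P * Q) t = 0" for t
    by (metis P Q fg poly_mult)
  then have "P * Q = 0"
    using poly_all_0_iff_0 by blast
  moreover have "P \<noteq> 0" using P[of 0] x by auto
  moreover have "Q \<noteq> 0" using Q[of 1] y by auto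
  ultimately show False by simp
qed

text \<open>Density principle: an identity checked only where \<open>f\<close> is nonzero holds
  everywhere, as soon as \<open>f\<close> has one nonzero \<open>p\<close>.\<close>

lemma poly_fun_cancel:
  assumes "f \<in> poly_fun" "g \<in> poly_fun" "f p \<noteq> 0" "\<And>x. f x \<noteq> 0 \<Longrightarrow> g x = 0"
  shows "g x = 0"
  using poly_fun_domain[OF assms(1,2)] assms(3,4) by (metis mult_eq_0_iff)

text \<open>One vector \<open>G\<close> serves all directions \<open>v\<close>; this linearity later
  makes the tangent space the kernel of a linear form.\<close>

lemma poly_fun_gradient:
  assumes "f \<in> poly_fun"
  shows "\<exists>G :: complex ^ 6. \<forall>v.
    ((\<lambda>t. f (p + t *s v)) has_field_derivative (\<Sum>i\<in>UNIV. G $ i * v $ i)) (at 0)"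
  using assms
proof induction
  case (const c)
  then show ?case by (intro exI[of _ 0]) simp
next
  case (var i)
  have *: "(\<Sum>j\<in>UNIV. axis i 1 $ j * v $ j) = v $ i" for v :: "complex ^ 6"
    by (simp add: axis_def if_distrib[of "\<lambda>x. x * _"] cong: if_cong)
  show ?case
    by (intro exI[of _ "axis i 1"]) (auto simp: * intro!: derivative_eq_intros)
next
  case (add f g)
  then obtain G H where
    G: "\<And>v. ((\<lambda>t. f (p + t *s v)) has_field_derivative (\<Sum>i\<in>UNIV. G $ i * v $ i)) (at 0)" and
    H: "\<And>v. ((\<lambda>t. g (p + t *s v)) has_field_derivative (\<Sum>i\<in>UNIV. H $ i * v $ i)) (at 0)"
    by blast
  show ?case
    by (intro exI[of _ "G + H"] allI)
      (use DERIV_add[OF G H] in \<open>simp add: algebra_simps sum.distrib\<close>)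
next
  case (mult f g)
  then obtain G H where
    G: "\<And>v. ((\<lambda>t. f (p + t *s v)) has_field_derivative (\<Sum>i\<in>UNIV. G $ i * v $ i)) (at 0)" and
    H: "\<And>v. ((\<lambda>t. g (p + t *s v)) has_field_derivative (\<Sum>i\<in>UNIV. H $ i * v $ i)) (at 0)"
    by blast
  show ?case
    by (intro exI[of _ "g p *s G + f p *s H"] allI)
      (use DERIV_mult[OF G H] in \<open>simp add: algebra_simps sum.distrib sum_distrib_left sum_distrib_right\<close>)
qed

section \<open>Zariski-closed sets\<close>

lemma zariski_closed_UNIV: "zariski_closed UNIV"
  unfolding zariski_closed_def by (intro exI[of _ "{}"]) simp

lemma zariski_closed_zeros: "f \<in> poly_fun \<Longrightarrow> zariski_closed {x. f x = 0}"
  unfolding zariski_closed_def by (intro exI[of _ "{f}"]) simp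

text \<open>If neither closed set contains \<open>Z\<close>, each has a defining polynomial that is
  nonzero somewhere on \<open>Z\<close>, while the product of the two vanishes on \<open>Z\<close>.
  Conversely, zero sets of single polynomials are closed.\<close>

lemma irreducible_closed_iff_prime:
  "irreducible_closed Z \<longleftrightarrow> zariski_closed Z \<and> Z \<noteq> {} \<and>
    (\<forall>f\<in>poly_fun. \<forall>g\<in>poly_fun. (\<forall>x\<in>Z. f x * g x = 0) \<longrightarrow>
      (\<forall>x\<in>Z. f x = 0) \<or> (\<forall>x\<in>Z. g x = 0))"
proof (intro iffI)
  assume Z: "irreducible_closed Z"
  have "(\<forall>x\<in>Z. f x = 0) \<or> (\<forall>x\<in>Z. g x = 0)"
    if f: "f \<in> poly_fun" and g: "g \<in> poly_fun" and fg: "\<forall>x\<in>Z. f x * g x = 0" for f g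
  proof -
    have "Z \<subseteq> {x. f x = 0} \<union> {x. g x = 0}" using fg by auto
    then have "Z \<subseteq> {x. f x = 0} \<or> Z \<subseteq> {x. g x = 0}"
      using Z zariski_closed_zeros[OF f] zariski_closed_zeros[OF g]
      unfolding irreducible_closed_def by metis
    then show ?thesis by blast
  qed
  then show "zariski_closed Z \<and> Z \<noteq> {} \<and>
    (\<forall>f\<in>poly_fun. \<forall>g\<in>poly_fun. (\<forall>x\<in>Z. f x * g x = 0) \<longrightarrow>
      (\<forall>x\<in>Z. f x = 0) \<or> (\<forall>x\<in>Z. g x = 0))"
    using Z unfolding irreducible_closed_def by auto
next
  assume Z: "zariski_closed Z \<and> Z \<noteq> {} \<and>
    (\<forall>f\<in>poly_fun. \<forall>g\<in>poly_fun. (\<forall>x\<in>Z. f x * g x = 0) \<longrightarrow>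
      (\<forall>x\<in>Z. f x = 0) \<or> (\<forall>x\<in>Z. g x = 0))"
  have "Z \<subseteq> A \<or> Z \<subseteq> B" if A: "zariski_closed A" and B: "zariski_closed B" and AB: "Z \<subseteq> A \<union> B" for A B
  proof -
    obtain F G where F: "F \<subseteq> poly_fun" "A = {x. \<forall>f\<in>F. f x = 0}"
      and G: "G \<subseteq> poly_fun" "B = {x. \<forall>f\<in>G. f x = 0}"
      using A B unfolding zariski_closed_def by blast
    have "g x = 0" if f: "f \<in> F" "y \<in> Z" "f y \<noteq> 0" and g: "g \<in> G" "x \<in> Z" for f g x y
    proof -
      have "\<forall>x\<in>Z. f x * g x = 0" using AB f(1) g(1) F G by fastforce
      then show ?thesis using Z f g F(1) G(1) by blast
    qed
    then show ?thesis using F(2) G(2) by blast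
  qed
  then show "irreducible_closed Z" using Z unfolding irreducible_closed_def by metis
qed

lemma irreducible_closed_UNIV: "irreducible_closed UNIV"
  unfolding irreducible_closed_iff_prime using zariski_closed_UNIV poly_fun_domain by auto

section \<open>Zariski closures of polynomial images\<close>

definition zariski_closure :: "(complex ^ 6) set \<Rightarrow> (complex ^ 6) set" where
  "zariski_closure S = {x. \<forall>g\<in>poly_fun. (\<forall>y\<in>S. g y = 0) \<longrightarrow> g x = 0}"

lemma zariski_closure_superset: "S \<subseteq> zariski_closure S"
  unfolding zariski_closure_def by auto

lemma zariski_closure_minimal: "zariski_closed X \<Longrightarrow> S \<subseteq> X \<Longrightarrow> zariski_closure S \<subseteq> X"
  unfolding zariski_closure_def zariski_closed_def by blast

lemma zariski_closed_closure: "zariski_closed (zariski_closure S)"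
  unfolding zariski_closed_def zariski_closure_def
  by (intro exI[of _ "{g \<in> poly_fun. \<forall>y\<in>S. g y = 0}"]) auto

text \<open>Pulling back along the parametrization moves primality to the whole space, where
  polynomial functions form a domain.\<close>

lemma irreducible_closure_range:
  assumes \<phi>: "\<And>i. (\<lambda>x. \<phi> x $ i) \<in> poly_fun"
  shows "irreducible_closed (zariski_closure (range \<phi>))" (is "irreducible_closed ?Z")
  unfolding irreducible_closed_iff_prime
proof (intro conjI ballI impI)
  show "zariski_closed ?Z" by (rule zariski_closed_closure)
  show "?Z \<noteq> {}" using zariski_closure_superset[of "range \<phi>"] by auto
  fix f g assume f: "f \<in> poly_fun" and g: "g \<in> poly_fun" and fg: "\<forall>x\<in>?Z. f x * g x = 0"
  then have "f (\<phi> t) * g (\<phi> t) = 0" for t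
    using zariski_closure_superset[of "range \<phi>"] by blast
  then have "(\<forall>t. f (\<phi> t) = 0) \<or> (\<forall>t. g (\<phi> t) = 0)"
    using poly_fun_domain poly_fun_compose[OF f \<phi>] poly_fun_compose[OF g \<phi>] by blast
  then show "(\<forall>x\<in>?Z. f x = 0) \<or> (\<forall>x\<in>?Z. g x = 0)"
    using f g unfolding zariski_closure_def by blast
qed

section \<open>The Cayley--Menger polynomial\<close>

definition vec6 :: "complex \<Rightarrow> complex \<Rightarrow> complex \<Rightarrow> complex \<Rightarrow> complex \<Rightarrow> complex \<Rightarrow> complex ^ 6" where
  "vec6 a b c d e f = (\<chi> i. if i = 1 then a else if i = 2 then b else if i = 3 then c
     else if i = 4 then d else if i = 5 then e else f)"

lemma vec6_nth [simp]:
  "vec6 a b c d e f $ 1 = a" "vec6 a b c d e f $ 2 = b" "vec6 a b c d e f $ 3 = c"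
  "vec6 a b c d e f $ 4 = d" "vec6 a b c d e f $ 5 = e" "vec6 a b c d e f $ 6 = f"
  by (simp_all add: vec6_def)

lemma vec6_poly_fun:
  assumes "a \<in> poly_fun" "b \<in> poly_fun" "c \<in> poly_fun" "d \<in> poly_fun" "e \<in> poly_fun" "f \<in> poly_fun"
  shows "(\<lambda>x. vec6 (a x) (b x) (c x) (d x) (e x) (f x) $ i) \<in> poly_fun"
  using exhaust_6[of i] assms by auto

definition cmA :: "complex ^ 6 \<Rightarrow> complex" where
  "cmA x = - 2 * (x $ 1)\<^sup>2"

definition cmB :: "complex ^ 6 \<Rightarrow> complex" where
  "cmB x = 8 * (x $ 3)\<^sup>2 * (x $ 5)\<^sup>2 - 4 * (x $ 3)\<^sup>2 * ((x $ 5)\<^sup>2 - (x $ 4)\<^sup>2)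
    - 2 * ((x $ 3)\<^sup>2 + (x $ 5)\<^sup>2 - (x $ 1)\<^sup>2)\<^sup>2
    + 2 * ((x $ 3)\<^sup>2 + (x $ 5)\<^sup>2 - (x $ 1)\<^sup>2) * ((x $ 3)\<^sup>2 - (x $ 2)\<^sup>2 + (x $ 5)\<^sup>2 - (x $ 4)\<^sup>2)
    - 4 * (x $ 5)\<^sup>2 * ((x $ 3)\<^sup>2 - (x $ 2)\<^sup>2)"

definition cmC :: "complex ^ 6 \<Rightarrow> complex" where
  "cmC x = - 2 * (x $ 3)\<^sup>2 * ((x $ 5)\<^sup>2 - (x $ 4)\<^sup>2)\<^sup>2
    + 2 * ((x $ 3)\<^sup>2 + (x $ 5)\<^sup>2 - (x $ 1)\<^sup>2) * ((x $ 3)\<^sup>2 - (x $ 2)\<^sup>2) * ((x $ 5)\<^sup>2 - (x $ 4)\<^sup>2)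
    - 2 * (x $ 5)\<^sup>2 * ((x $ 3)\<^sup>2 - (x $ 2)\<^sup>2)\<^sup>2"

definition cmF :: "complex ^ 6 \<Rightarrow> complex" where
  "cmF x = cmA x * (x $ 6) ^ 4 + cmB x * (x $ 6)\<^sup>2 + cmC x"

text \<open>By Heron's formula this is -16 times the squared area of the triangle with sides
  \<open>a\<close>, \<open>b\<close>, \<open>c\<close>.\<close>

definition heron :: "complex \<Rightarrow> complex \<Rightarrow> complex \<Rightarrow> complex" where
  "heron a b c = (a + b + c) * (a + b - c) * (a - b + c) * (a - b - c)"

lemma det_CM_matrix: "det (CM_matrix x) = cmF x"
  unfolding CM_matrix_def Let_def coord_simps det_3 cmF_def cmA_def cmB_def cmC_def
  by (simp add: algebra_simps power2_eq_square power4_eq_xxxx)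

lemma L24_eq: "L24 = {x. cmF x = 0}"
  by (simp add: L24_def det_CM_matrix)

lemma cm_discriminant:
  "(cmB x)\<^sup>2 - 4 * cmA x * cmC x = 4 * heron (x $ 1) (x $ 2) (x $ 4) * heron (x $ 1) (x $ 3) (x $ 5)"
  unfolding cmA_def cmB_def cmC_def heron_def by algebra

lemma cm_poly_fun: "cmA \<in> poly_fun" "cmB \<in> poly_fun" "cmC \<in> poly_fun" "cmF \<in> poly_fun"
  unfolding cmA_def cmB_def cmC_def cmF_def by (intro poly_fun_intros)+

section \<open>Division by the Cayley--Menger polynomial in the last coordinate\<close>

definition set_last :: "complex ^ 6 \<Rightarrow> complex \<Rightarrow> complex ^ 6" where
  "set_last x t = vec6 (x $ 1) (x $ 2) (x $ 3) (x $ 4) (x $ 5) t"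

text \<open>The coefficient ring of polynomials in the first five coordinates, encoded as invariance
  under changes of the last one.\<close>

definition last_free :: "(complex ^ 6 \<Rightarrow> complex) set" where
  "last_free = {f \<in> poly_fun. \<forall>x t. f (set_last x t) = f x}"

lemma set_last_nth [simp]:
  "set_last x t $ 1 = x $ 1" "set_last x t $ 2 = x $ 2" "set_last x t $ 3 = x $ 3"
  "set_last x t $ 4 = x $ 4" "set_last x t $ 5 = x $ 5" "set_last x t $ 6 = t"
  by (simp_all add: set_last_def)

lemma last_free_poly_fun: "f \<in> last_free \<Longrightarrow> f \<in> poly_fun"
  by (simp add: last_free_def)

lemma last_free_set_last: "f \<in> last_free \<Longrightarrow> f (set_last x t) = f x"
  by (simp add: last_free_def)

lemma last_free_const: "(\<lambda>x. c) \<in> last_free"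
  by (simp add: last_free_def poly_fun.const)

lemma last_free_var: "i \<noteq> 6 \<Longrightarrow> (\<lambda>x. x $ i) \<in> last_free"
  using exhaust_6[of i] by (auto simp: last_free_def poly_fun.var)

lemma last_free_ops:
  assumes "f \<in> last_free" "g \<in> last_free"
  shows "(\<lambda>x. f x + g x) \<in> last_free" "(\<lambda>x. f x - g x) \<in> last_free" "(\<lambda>x. f x * g x) \<in> last_free"
  using assms by (simp_all add: last_free_def poly_fun_intros)

lemma last_free_power: "f \<in> last_free \<Longrightarrow> (\<lambda>x. f x ^ n) \<in> last_free"
  by (simp add: last_free_def poly_fun_power)

lemma last_free_cm: "cmA \<in> last_free" "cmB \<in> last_free" "cmC \<in> last_free"
  using cm_poly_fun by (simp_all add: last_free_def cmA_def cmB_def cmC_def)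

lemmas last_free_intros = last_free_const last_free_var last_free_ops last_free_power last_free_cm

text \<open>Pseudo-division by a quartic with leading coefficient \<open>cmA\<close>. Induction over
  the generation of \<open>g\<close> leaves only one real reduction: the product of two cubic
  remainders, of degree at most six.\<close>

lemma cm_division:
  assumes "g \<in> poly_fun"
  shows "\<exists>k. \<exists>h\<in>poly_fun. \<exists>r0\<in>last_free. \<exists>r1\<in>last_free. \<exists>r2\<in>last_free. \<exists>r3\<in>last_free.
    \<forall>x. cmA x ^ k * g x
      = cmF x * h x + (r0 x + r1 x * x $ 6 + r2 x * (x $ 6)\<^sup>2 + r3 x * (x $ 6) ^ 3)"
  using assms
proof induction
  case (const c)
  show ?case
    by (rule exI[of _ 0], rule bexI[of _ "\<lambda>x. 0"], rule bexI[of _ "\<lambda>x. c"],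
        rule bexI[of _ "\<lambda>x. 0"], rule bexI[of _ "\<lambda>x. 0"], rule bexI[of _ "\<lambda>x. 0"])
      (auto intro: poly_fun.const last_free_const)
next
  case (var i)
  show ?case
  proof (cases "i = 6")
    case True
    show ?thesis
      by (rule exI[of _ 0], rule bexI[of _ "\<lambda>x. 0"], rule bexI[of _ "\<lambda>x. 0"],
          rule bexI[of _ "\<lambda>x. 1"], rule bexI[of _ "\<lambda>x. 0"], rule bexI[of _ "\<lambda>x. 0"])
        (auto intro: poly_fun.const last_free_const simp: True)
  next
    case False
    show ?thesis
      by (rule exI[of _ 0], rule bexI[of _ "\<lambda>x. 0"], rule bexI[of _ "\<lambda>x. x $ i"],
          rule bexI[of _ "\<lambda>x. 0"], rule bexI[of _ "\<lambda>x. 0"], rule bexI[of _ "\<lambda>x. 0"])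
        (auto intro: poly_fun.const last_free_const last_free_var simp: False)
  qed
next
  case (add f g)
  then obtain k h r0 r1 r2 r3 k' h' s0 s1 s2 s3 where
    r: "h \<in> poly_fun" "r0 \<in> last_free" "r1 \<in> last_free" "r2 \<in> last_free" "r3 \<in> last_free"
      "\<And>x. cmA x ^ k * f x
        = cmF x * h x + (r0 x + r1 x * x $ 6 + r2 x * (x $ 6)\<^sup>2 + r3 x * (x $ 6) ^ 3)" and
    s: "h' \<in> poly_fun" "s0 \<in> last_free" "s1 \<in> last_free" "s2 \<in> last_free" "s3 \<in> last_free"
      "\<And>x. cmA x ^ k' * g x
        = cmF x * h' x + (s0 x + s1 x * x $ 6 + s2 x * (x $ 6)\<^sup>2 + s3 x * (x $ 6) ^ 3)"
    by blast
  have eq: "cmA x ^ (k + k') * (f x + g x)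
      = cmF x * (cmA x ^ k' * h x + cmA x ^ k * h' x)
        + ((cmA x ^ k' * r0 x + cmA x ^ k * s0 x) + (cmA x ^ k' * r1 x + cmA x ^ k * s1 x) * x $ 6
        + (cmA x ^ k' * r2 x + cmA x ^ k * s2 x) * (x $ 6)\<^sup>2
        + (cmA x ^ k' * r3 x + cmA x ^ k * s3 x) * (x $ 6) ^ 3)" for x
  proof -
    have "cmA x ^ (k + k') * (f x + g x) = cmA x ^ k' * (cmA x ^ k * f x) + cmA x ^ k * (cmA x ^ k' * g x)"
      by (simp add: power_add algebra_simps)
    then show ?thesis unfolding r(6) s(6) by (simp add: algebra_simps)
  qed
  show ?case
    by (rule exI[of _ "k + k'"], rule bexI[of _ "\<lambda>x. cmA x ^ k' * h x + cmA x ^ k * h' x"],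
        rule bexI[of _ "\<lambda>x. cmA x ^ k' * r0 x + cmA x ^ k * s0 x"],
        rule bexI[of _ "\<lambda>x. cmA x ^ k' * r1 x + cmA x ^ k * s1 x"],
        rule bexI[of _ "\<lambda>x. cmA x ^ k' * r2 x + cmA x ^ k * s2 x"],
        rule bexI[of _ "\<lambda>x. cmA x ^ k' * r3 x + cmA x ^ k * s3 x"])
      (use eq r s in \<open>auto intro!: poly_fun_intros last_free_intros cm_poly_fun\<close>)
next
  case (mult f g)
  then obtain k h r0 r1 r2 r3 k' h' s0 s1 s2 s3 where
    r: "h \<in> poly_fun" "r0 \<in> last_free" "r1 \<in> last_free" "r2 \<in> last_free" "r3 \<in> last_free"
      "\<And>x. cmA x ^ k * f x
        = cmF x * h x + (r0 x + r1 x * x $ 6 + r2 x * (x $ 6)\<^sup>2 + r3 x * (x $ 6) ^ 3)" and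
    s: "h' \<in> poly_fun" "s0 \<in> last_free" "s1 \<in> last_free" "s2 \<in> last_free" "s3 \<in> last_free"
      "\<And>x. cmA x ^ k' * g x
        = cmF x * h' x + (s0 x + s1 x * x $ 6 + s2 x * (x $ 6)\<^sup>2 + s3 x * (x $ 6) ^ 3)"
    by blast
  define R where "R = (\<lambda>x. r0 x + r1 x * x $ 6 + r2 x * (x $ 6)\<^sup>2 + r3 x * (x $ 6) ^ 3)"
  define S where "S = (\<lambda>x. s0 x + s1 x * x $ 6 + s2 x * (x $ 6)\<^sup>2 + s3 x * (x $ 6) ^ 3)"
  \<comment> \<open>\<open>u4\<close>, \<open>u5\<close>, \<open>u6\<close> are the coefficients of
    y^4, y^5, y^6 in the product of the remainders. As \<open>cmF\<close> is even in y, two factors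
    of A suffice: A y^4 = F - B y^2 - C and A^2 y^6 = F (A y^2 - B) + (B^2 - A C) y^2 + B C.\<close>
  define u4 where "u4 = (\<lambda>x. r1 x * s3 x + r2 x * s2 x + r3 x * s1 x)"
  define u5 where "u5 = (\<lambda>x. r2 x * s3 x + r3 x * s2 x)"
  define u6 where "u6 = (\<lambda>x. r3 x * s3 x)"
  define t0 where "t0 = (\<lambda>x. (cmA x)\<^sup>2 * (r0 x * s0 x) - cmA x * cmC x * u4 x + cmB x * cmC x * u6 x)"
  define t1 where "t1 = (\<lambda>x. (cmA x)\<^sup>2 * (r0 x * s1 x + r1 x * s0 x) - cmA x * cmC x * u5 x)"
  define t2 where "t2 = (\<lambda>x. (cmA x)\<^sup>2 * (r0 x * s2 x + r1 x * s1 x + r2 x * s0 x)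
    - cmA x * cmB x * u4 x + ((cmB x)\<^sup>2 - cmA x * cmC x) * u6 x)"
  define t3 where "t3 = (\<lambda>x. (cmA x)\<^sup>2 * (r0 x * s3 x + r1 x * s2 x + r2 x * s1 x + r3 x * s0 x)
    - cmA x * cmB x * u5 x)"
  define H where "H = (\<lambda>x. (cmA x)\<^sup>2 * (cmF x * h x * h' x + h x * S x + h' x * R x)
    + cmA x * u4 x + cmA x * u5 x * x $ 6 + (cmA x * (x $ 6)\<^sup>2 - cmB x) * u6 x)"
  have RS: "(cmA x)\<^sup>2 * (R x * S x) =
      cmF x * (cmA x * u4 x + cmA x * u5 x * x $ 6 + (cmA x * (x $ 6)\<^sup>2 - cmB x) * u6 x)
      + (t0 x + t1 x * x $ 6 + t2 x * (x $ 6)\<^sup>2 + t3 x * (x $ 6) ^ 3)" for x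
    unfolding R_def S_def t0_def t1_def t2_def t3_def u4_def u5_def u6_def cmF_def by algebra
  have eq: "cmA x ^ (k + k' + 2) * (f x * g x)
      = cmF x * H x + (t0 x + t1 x * x $ 6 + t2 x * (x $ 6)\<^sup>2 + t3 x * (x $ 6) ^ 3)" for x
  proof -
    have "cmA x ^ (k + k' + 2) * (f x * g x) = (cmA x)\<^sup>2 * ((cmA x ^ k * f x) * (cmA x ^ k' * g x))"
      by (simp add: power_add power2_eq_square algebra_simps)
    also have "\<dots> = (cmA x)\<^sup>2 * ((cmF x * h x + R x) * (cmF x * h' x + S x))"
      unfolding r(6) s(6) R_def S_def ..
    also have "\<dots> = cmF x * ((cmA x)\<^sup>2 * (cmF x * h x * h' x + h x * S x + h' x * R x))
        + (cmA x)\<^sup>2 * (R x * S x)"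
      by (simp add: algebra_simps)
    also have "\<dots> = cmF x * H x + (t0 x + t1 x * x $ 6 + t2 x * (x $ 6)\<^sup>2 + t3 x * (x $ 6) ^ 3)"
      unfolding RS H_def by (simp add: algebra_simps)
    finally show ?thesis .
  qed
  note rs = r(1-5) s(1-5)
  have u: "u4 \<in> last_free" "u5 \<in> last_free" "u6 \<in> last_free"
    unfolding u4_def u5_def u6_def by (intro last_free_intros rs)+
  have t: "t0 \<in> last_free" "t1 \<in> last_free" "t2 \<in> last_free" "t3 \<in> last_free"
    unfolding t0_def t1_def t2_def t3_def by (intro last_free_intros rs u)+
  have "H \<in> poly_fun"
    unfolding H_def R_def S_def
    by (intro poly_fun_intros cm_poly_fun u[THEN last_free_poly_fun] r(1) s(1)
        r(2-5)[THEN last_free_poly_fun] s(2-5)[THEN last_free_poly_fun])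
  then show ?case using eq t by blast
qed

lemma cubic_remainder_vanishes:
  assumes r: "r0 \<in> last_free" "r1 \<in> last_free" "r2 \<in> last_free" "r3 \<in> last_free"
    and van: "\<And>x. x \<in> L24 \<Longrightarrow> r0 x + r1 x * x $ 6 + r2 x * (x $ 6)\<^sup>2 + r3 x * (x $ 6) ^ 3 = 0"
  shows "r0 x = 0 \<and> r1 x = 0 \<and> r2 x = 0 \<and> r3 x = 0"
proof -
  \<comment> \<open>The three factors guarantee degree four, exclude the root 0, and keep the two
    values of y^2 apart.\<close>
  define D where "D = (\<lambda>x. cmA x * cmC x * ((cmB x)\<^sup>2 - 4 * cmA x * cmC x))"
  have D: "D \<in> poly_fun" unfolding D_def by (intro poly_fun_intros cm_poly_fun)
  \<comment> \<open>The triangles 123 and 124 get sides 2, 2, 2 and 2, 1, 2, both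
    nondegenerate.\<close>
  have D0: "D (vec6 2 2 1 2 2 0) \<noteq> 0"
    unfolding D_def cm_discriminant heron_def by (simp add: cmA_def cmC_def)
  have generic: "r0 x = 0 \<and> r1 x = 0 \<and> r2 x = 0 \<and> r3 x = 0" if "D x \<noteq> 0" for x
  proof -
    define \<delta> where "\<delta> = csqrt ((cmB x)\<^sup>2 - 4 * cmA x * cmC x)"
    have \<delta>2: "\<delta>\<^sup>2 = (cmB x)\<^sup>2 - 4 * cmA x * cmC x" by (simp add: \<delta>_def)
    have nz: "cmA x \<noteq> 0" "cmC x \<noteq> 0" "\<delta> \<noteq> 0" using that \<delta>2 by (auto simp: D_def)
    define u where "u = csqrt ((- cmB x + \<delta>) / (2 * cmA x))"
    define w where "w = csqrt ((- cmB x - \<delta>) / (2 * cmA x))"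
    have u2: "u\<^sup>2 = (- cmB x + \<delta>) / (2 * cmA x)" and w2: "w\<^sup>2 = (- cmB x - \<delta>) / (2 * cmA x)"
      by (simp_all add: u_def w_def)
    have u2': "2 * cmA x * u\<^sup>2 = - cmB x + \<delta>" and w2': "2 * cmA x * w\<^sup>2 = - cmB x - \<delta>"
      using nz(1) unfolding u2 w2 by simp_all
    have "4 * cmA x * (cmA x * u\<^sup>2 * u\<^sup>2 + cmB x * u\<^sup>2 + cmC x) = 0"
      "4 * cmA x * (cmA x * w\<^sup>2 * w\<^sup>2 + cmB x * w\<^sup>2 + cmC x) = 0"
      using u2' w2' \<delta>2 by algebra+
    then have qu: "cmA x * u\<^sup>2 * u\<^sup>2 + cmB x * u\<^sup>2 + cmC x = 0"
      and qw: "cmA x * w\<^sup>2 * w\<^sup>2 + cmB x * w\<^sup>2 + cmC x = 0"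
      using nz(1) by simp_all
    have uw: "u \<noteq> 0" "w \<noteq> 0" using qu qw nz(2) by auto
    have "2 * cmA x * (u\<^sup>2 - w\<^sup>2) = 2 * \<delta>" using u2' w2' by algebra
    then have uw2: "u\<^sup>2 - w\<^sup>2 \<noteq> 0" using nz(3) by auto
    have root: "r0 x + r1 x * y + r2 x * y\<^sup>2 + r3 x * y ^ 3 = 0"
      if "cmA x * y\<^sup>2 * y\<^sup>2 + cmB x * y\<^sup>2 + cmC x = 0" for y
    proof -
      have "cmF (set_last x y) = 0"
        using that by (simp add: cmF_def last_free_set_last last_free_cm power4_eq_xxxx power2_eq_square mult.assoc)
      then have "set_last x y \<in> L24" by (simp add: L24_eq)
      from van[OF this] show ?thesis using r by (simp add: last_free_set_last)
    qed
    have a: "r0 x + r1 x * u + r2 x * u\<^sup>2 + r3 x * u ^ 3 = 0" "r0 x + r1 x * w + r2 x * w\<^sup>2 + r3 x * w ^ 3 = 0"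
      using root qu qw by blast+
    \<comment> \<open>The quartic is even, so the negatives of \<open>u\<close> and \<open>w\<close>
      are roots too. Sums and differences separate the even and the odd part of the cubic, each
      linear in y^2 with two distinct zeros.\<close>
    have b: "r0 x + r1 x * (-u) + r2 x * (-u)\<^sup>2 + r3 x * (-u) ^ 3 = 0"
       "r0 x + r1 x * (-w) + r2 x * (-w)\<^sup>2 + r3 x * (-w) ^ 3 = 0"
      by (rule root, use qu qw in simp)+
    have "2 * (r0 x + r2 x * u\<^sup>2) = 0" "2 * (r0 x + r2 x * w\<^sup>2) = 0"
      "2 * u * (r1 x + r3 x * u\<^sup>2) = 0" "2 * w * (r1 x + r3 x * w\<^sup>2) = 0"
      using a b by algebra+
    then have c: "r0 x + r2 x * u\<^sup>2 = 0" "r0 x + r2 x * w\<^sup>2 = 0"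
      "r1 x + r3 x * u\<^sup>2 = 0" "r1 x + r3 x * w\<^sup>2 = 0" using uw unfolding mult_eq_0_iff by simp_all
    have "r2 x * (u\<^sup>2 - w\<^sup>2) = 0" "r3 x * (u\<^sup>2 - w\<^sup>2) = 0" using c by algebra+
    then have "r2 x = 0" "r3 x = 0" using uw2 by simp_all
    then show ?thesis using c by simp
  qed
  show ?thesis
    using poly_fun_cancel[OF D _ D0] generic r[THEN last_free_poly_fun] by metis
qed

text \<open>Factor theorem for l12. With f0 and g0 the values at l12 = 0, products are handled by f
  g - f0 g0 = (f - f0) g + f0 (g - g0).\<close>

lemma poly_fun_factor_first:
  assumes "h \<in> poly_fun"
  shows "\<exists>h'\<in>poly_fun. \<forall>x. h x = h (vec6 0 (x $ 2) (x $ 3) (x $ 4) (x $ 5) (x $ 6)) + x $ 1 * h' x"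
  using assms
proof induction
  case (const c)
  show ?case by (rule bexI[of _ "\<lambda>x. 0"]) (auto intro: poly_fun_intros)
next
  case (var i)
  show ?case
  proof (cases "i = 1")
    case True
    then show ?thesis by (intro bexI[of _ "\<lambda>x. 1"]) (auto intro: poly_fun_intros)
  next
    case False
    then show ?thesis
      by (intro bexI[of _ "\<lambda>x. 0"]) (use exhaust_6[of i] in \<open>auto intro: poly_fun_intros\<close>)
  qed
next
  case (add f g)
  then obtain f' g' where *: "f' \<in> poly_fun" "g' \<in> poly_fun"
    "\<And>x. f x = f (vec6 0 (x $ 2) (x $ 3) (x $ 4) (x $ 5) (x $ 6)) + x $ 1 * f' x"
    "\<And>x. g x = g (vec6 0 (x $ 2) (x $ 3) (x $ 4) (x $ 5) (x $ 6)) + x $ 1 * g' x" by blast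
  have eq: "f x + g x = f (vec6 0 (x $ 2) (x $ 3) (x $ 4) (x $ 5) (x $ 6))
      + g (vec6 0 (x $ 2) (x $ 3) (x $ 4) (x $ 5) (x $ 6)) + x $ 1 * (f' x + g' x)" for x
    using *(3,4)[of x] by algebra
  show ?case
    by (rule bexI[of _ "\<lambda>x. f' x + g' x"]) (intro allI eq, intro poly_fun_intros *(1,2))
next
  case (mult f g)
  then obtain f' g' where *: "f' \<in> poly_fun" "g' \<in> poly_fun"
    "\<And>x. f x = f (vec6 0 (x $ 2) (x $ 3) (x $ 4) (x $ 5) (x $ 6)) + x $ 1 * f' x"
    "\<And>x. g x = g (vec6 0 (x $ 2) (x $ 3) (x $ 4) (x $ 5) (x $ 6)) + x $ 1 * g' x" by blast
  have eq: "f x * g x = f (vec6 0 (x $ 2) (x $ 3) (x $ 4) (x $ 5) (x $ 6)) * g (vec6 0 (x $ 2) (x $ 3) (x $ 4) (x $ 5) (x $ 6))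
     + x $ 1 * (f' x * g x + g' x * f (vec6 0 (x $ 2) (x $ 3) (x $ 4) (x $ 5) (x $ 6)))" for x
    using *(3,4)[of x] by algebra
  show ?case
    by (rule bexI[of _ "\<lambda>x. f' x * g x + g' x * f (vec6 0 (x $ 2) (x $ 3) (x $ 4) (x $ 5) (x $ 6))"])
      (intro allI eq, intro poly_fun_intros poly_fun_compose[OF mult(1)] vec6_poly_fun *(1,2) mult(2))
qed

text \<open>At l12 = 0 the determinant does not vanish identically, so the cofactor \<open>h\<close>
  must vanish there, and l12 divides it.\<close>

lemma cmF_strip_first:
  assumes g: "g \<in> poly_fun" and h: "h \<in> poly_fun" and eq: "\<And>x. x $ 1 * g x = cmF x * h x"
  shows "\<exists>h'\<in>poly_fun. \<forall>x. g x = cmF x * h' x"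
proof -
  let ?z = "\<lambda>x :: complex ^ 6. vec6 0 (x $ 2) (x $ 3) (x $ 4) (x $ 5) (x $ 6)"
  have z: "(\<lambda>x. ?z x $ i) \<in> poly_fun" for i
    by (intro vec6_poly_fun poly_fun_intros)
  have "cmF (?z x) * h (?z x) = 0" for x
    using eq[of "?z x"] by simp
  then have "(\<forall>x. cmF (?z x) = 0) \<or> (\<forall>x. h (?z x) = 0)"
    using poly_fun_domain poly_fun_compose[OF cm_poly_fun(4) z] poly_fun_compose[OF h z] by blast
  moreover have "cmF (?z (vec6 0 0 0 1 1 1)) \<noteq> 0"
    by (simp add: cmF_def cmA_def cmB_def cmC_def)
  ultimately have hz: "h (?z x) = 0" for x by blast
  obtain h' where h': "h' \<in> poly_fun" "\<And>x. h x = h (?z x) + x $ 1 * h' x"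
    using poly_fun_factor_first[OF h] by blast
  have *: "x $ 1 * (g x - cmF x * h' x) = 0" for x
    using eq[of x] h'(2)[of x] hz[of x] by (simp add: algebra_simps)
  have "g x - cmF x * h' x = 0" for x
    by (rule poly_fun_cancel[of "\<lambda>x. x $ 1" _ "vec6 1 0 0 0 0 0"])
      (use * in \<open>auto intro!: poly_fun_intros g h' cm_poly_fun\<close>)
  then show ?thesis using h'(1) by auto
qed

text \<open>\<open>cmA\<close> is -2 l12^2, so its powers are powers of l12 up to a constant and can
  be removed one l12 at a time.\<close>

lemma cmF_strip:
  assumes g: "g \<in> poly_fun" and h: "h \<in> poly_fun" and eq: "\<And>x. cmA x ^ k * g x = cmF x * h x"
  shows "\<exists>h'\<in>poly_fun. \<forall>x. g x = cmF x * h' x"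
proof -
  have *: "\<exists>h'\<in>poly_fun. \<forall>x. g x = cmF x * h' x"
    if "h \<in> poly_fun" "\<And>x. (x $ 1) ^ n * g x = cmF x * h x" for n h
    using that
  proof (induction n arbitrary: h)
    case (Suc n)
    have "\<exists>h'\<in>poly_fun. \<forall>x. (x $ 1) ^ n * g x = cmF x * h' x"
      by (rule cmF_strip_first[OF _ Suc.prems(1)])
        (use Suc.prems(2) in \<open>auto intro!: poly_fun_intros g simp: algebra_simps\<close>)
    then show ?case using Suc.IH by blast
  qed auto
  show ?thesis
  proof (rule *)
    show "(\<lambda>x. (- 1 / 2) ^ k * h x) \<in> poly_fun" by (intro poly_fun_intros h)
    show "(x $ 1) ^ (2 * k) * g x = cmF x * ((- 1 / 2) ^ k * h x)" for x
    proof -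
      have "(x $ 1) ^ (2 * k) = (- 1 / 2) ^ k * cmA x ^ k"
        by (simp add: cmA_def power_mult flip: power_mult_distrib)
      then show ?thesis using eq[of x] by (simp add: algebra_simps)
    qed
  qed
qed

text \<open>This excludes multiple factors of the determinant, so that tangent spaces can be read
  off from \<open>cmF\<close> alone.\<close>

theorem vanishing_ideal_L24:
  "vanishing_ideal L24 = {g \<in> poly_fun. \<exists>h\<in>poly_fun. \<forall>x. g x = cmF x * h x}"
proof (intro equalityI subsetI CollectI conjI)
  fix g assume "g \<in> vanishing_ideal L24"
  then have g: "g \<in> poly_fun" "\<And>x. x \<in> L24 \<Longrightarrow> g x = 0" by (auto simp: vanishing_ideal_def)
  show "g \<in> poly_fun" by fact
  obtain k h r0 r1 r2 r3 where
    r: "h \<in> poly_fun" "r0 \<in> last_free" "r1 \<in> last_free" "r2 \<in> last_free" "r3 \<in> last_free"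
      "\<And>x. cmA x ^ k * g x
        = cmF x * h x + (r0 x + r1 x * x $ 6 + r2 x * (x $ 6)\<^sup>2 + r3 x * (x $ 6) ^ 3)"
    using cm_division[OF g(1)] by blast
  have "r0 x + r1 x * x $ 6 + r2 x * (x $ 6)\<^sup>2 + r3 x * (x $ 6) ^ 3 = 0" if "x \<in> L24" for x
    using r(6)[of x] g(2)[OF that] that by (simp add: L24_eq)
  from cubic_remainder_vanishes[OF r(2-5) this]
  have "cmA x ^ k * g x = cmF x * h x" for x using r(6)[of x] by simp
  then show "\<exists>h\<in>poly_fun. \<forall>x. g x = cmF x * h x" by (rule cmF_strip[OF g(1) r(1)])
qed (auto simp: vanishing_ideal_def L24_eq)

section \<open>Irreducibility of the hypersurface\<close>

text \<open>On a line through the simple zero, the order of vanishing of \<open>f\<^sup>2\<close> is even and that of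
  \<open>D g\<^sup>2\<close> is odd.\<close>
lemma not_square_if_simple_zero:
  assumes f: "f \<in> poly_fun" and g: "g \<in> poly_fun" and D: "D \<in> poly_fun"
    and eq: "\<And>x. (f x)\<^sup>2 = D x * (g x)\<^sup>2"
    and q: "D q = 0" "((\<lambda>t. D (q + t *s v)) has_field_derivative c) (at 0)" "c \<noteq> 0"
  shows "g x = 0"
proof (rule ccontr)
  assume gx: "g x \<noteq> 0"
  obtain G :: "complex ^ 6" where
    G: "\<And>w. ((\<lambda>t. D (q + t *s w)) has_field_derivative (\<Sum>i\<in>UNIV. G $ i * w $ i)) (at 0)"
    using poly_fun_gradient[OF D] by blast
  define dD where "dD = (\<lambda>w :: complex ^ 6. \<Sum>i\<in>UNIV. G $ i * w $ i)"
  have dD: "dD \<in> poly_fun" unfolding dD_def by (intro poly_fun_intros)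
  have "dD v \<noteq> 0" using DERIV_unique[OF G q(2)] q(3) by (simp add: dD_def)
  moreover have gq: "(\<lambda>w. g (q + w)) \<in> poly_fun"
    by (rule poly_fun_compose[OF g]) (auto intro: poly_fun_intros)
  moreover have "g (q + (x - q)) \<noteq> 0" using gx by simp
  \<comment> \<open>The given direction \<open>v\<close> need not meet a nonzero of
    \<open>g\<close>. Both requirements on a direction are nonvanishing conditions, so some
    \<open>w\<close> satisfies them together.\<close>
  ultimately obtain w where w: "dD w \<noteq> 0" "g (q + w) \<noteq> 0"
    using poly_fun_domain[OF dD gq] by (metis mult_eq_0_iff)
  obtain P where P: "\<And>t. f (q + t *s w) = poly P t" using poly_fun_on_line[OF f] by blast
  obtain Q where Q: "\<And>t. g (q + t *s w) = poly Q t" using poly_fun_on_line[OF g] by blast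
  obtain E where E: "\<And>t. D (q + t *s w) = poly E t" using poly_fun_on_line[OF D] by blast
  have "poly (P\<^sup>2) t = poly (E * Q\<^sup>2) t" for t
    using eq[of "q + t *s w"] by (simp add: P Q E)
  then have PQ: "P\<^sup>2 = E * Q\<^sup>2" by (simp add: fun_eq_iff flip: poly_eq_poly_eq_iff)
  have "Q \<noteq> 0" using Q[of 1] w(2) by auto
  have "poly (pderiv E) 0 = dD w"
  proof (rule DERIV_unique)
    show "(poly E has_field_derivative poly (pderiv E) 0) (at 0)" by (rule poly_DERIV)
    show "(poly E has_field_derivative dD w) (at 0)" using G[of w] by (simp add: E dD_def)
  qed
  then have E': "poly (pderiv E) 0 \<noteq> 0" using w(1) by simp
  then have "E \<noteq> 0" by auto
  have "poly E 0 = 0" using E[of 0] q(1) by simp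
  then obtain E1 where E1: "E = [:0, 1:] * E1" using poly_eq_0_iff_dvd[of E 0] by (auto elim: dvdE)
  have "poly E1 0 \<noteq> 0" using E' unfolding E1 pderiv_mult by (simp add: pderiv_pCons)
  then have "order 0 E1 = 0" by (rule order_0I)
  moreover have "order 0 [:0, 1:: complex:] = 1" using order_power_n_n[of 0 1] by simp
  ultimately have oE: "order 0 E = 1" using order_mult[OF \<open>E \<noteq> 0\<close>[unfolded E1], of 0] unfolding E1 by linarith
  have "E * Q\<^sup>2 \<noteq> 0" using \<open>E \<noteq> 0\<close> \<open>Q \<noteq> 0\<close> by simp
  then have "order 0 (E * Q\<^sup>2) = 1 + 2 * order 0 Q" "P \<noteq> 0"
    using oE \<open>Q \<noteq> 0\<close> PQ by (auto simp: order_mult power2_eq_square)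
  moreover have "order 0 (P\<^sup>2) = 2 * order 0 P"
    using \<open>P \<noteq> 0\<close> by (simp add: order_mult power2_eq_square)
  ultimately show False unfolding PQ by presburger
qed

lemma discriminant_not_square:
  assumes "f \<in> poly_fun" "g \<in> poly_fun"
    and "\<And>x. (f x)\<^sup>2 = ((cmB x)\<^sup>2 - 4 * cmA x * cmC x) * (g x)\<^sup>2"
  shows "g x = 0"
proof (rule not_square_if_simple_zero[OF assms(1,2) _ assms(3)])
  \<comment> \<open>Triangle 123 has sides 3, 2, 1 and is degenerate, while 124 is equilateral with
    side 3: exactly one linear factor of the discriminant vanishes, and to first order along
    l12.\<close>
  let ?q = "vec6 3 2 3 1 3 0" and ?v = "vec6 1 0 0 0 0 0"
  let ?D = "\<lambda>x. (cmB x)\<^sup>2 - 4 * cmA x * cmC x"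
  show "?D \<in> poly_fun" by (intro poly_fun_intros cm_poly_fun)
  show "?D ?q = 0" unfolding cm_discriminant heron_def by simp
  have "?D (?q + t *s ?v) = t * (4 * (6 + t) * (4 + t) * (2 + t) * heron (3 + t) 3 3)" for t
    unfolding cm_discriminant heron_def by simp
  then show "((\<lambda>t. ?D (?q + t *s ?v)) has_field_derivative 4 * 6 * 4 * 2 * heron 3 3 3) (at 0)"
    by (auto simp: heron_def intro!: derivative_eq_intros)
  show "4 * 6 * 4 * 2 * heron 3 3 3 \<noteq> 0" by (simp add: heron_def)
qed

lemma cmC_not_square:
  assumes "f \<in> poly_fun" "g \<in> poly_fun" and "\<And>x. (f x)\<^sup>2 = - 2 * cmC x * (g x)\<^sup>2"
  shows "g x = 0"
proof (rule not_square_if_simple_zero[OF assms(1,2) _ assms(3)])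
  \<comment> \<open>For l13 = l24 = 0 the polynomial is 4 l14^2 l23^2 (l14^2 + l23^2 - l12^2); the
    triple 3, 4, 5 gives a simple zero in l12.\<close>
  let ?q = "vec6 5 0 3 4 0 0" and ?v = "vec6 1 0 0 0 0 0"
  let ?D = "\<lambda>x. - 2 * cmC x"
  show "?D \<in> poly_fun" by (intro poly_fun_intros cm_poly_fun)
  show "?D ?q = 0" by (simp add: cmC_def)
  have "?D (?q + t *s ?v) = - 576 * t * (10 + t)" for t
    by (simp add: cmC_def algebra_simps power2_eq_square)
  then show "((\<lambda>t. ?D (?q + t *s ?v)) has_field_derivative - 5760) (at 0)"
    by (auto intro!: derivative_eq_intros)
qed auto

lemma cmA_nonzero: "cmA (vec6 1 0 0 0 0 0) \<noteq> 0"
  by (simp add: cmA_def)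

text \<open>The form is A times the norm (r + s z)(r + s z'), with z and z' the roots of A z^2 + B z
  + C. If it vanishes, completing the square exhibits the discriminant times s^2 as a
  square.\<close>

lemma last_free_norm_nonzero:
  assumes r: "r \<in> last_free" "s \<in> last_free"
    and N: "\<And>x. cmA x * (r x)\<^sup>2 - cmB x * r x * s x + cmC x * (s x)\<^sup>2 = 0"
  shows "r x = 0 \<and> s x = 0"
proof -
  note rp = r[THEN last_free_poly_fun]
  have "(2 * cmA x * r x - cmB x * s x)\<^sup>2 = ((cmB x)\<^sup>2 - 4 * cmA x * cmC x) * (s x)\<^sup>2" for x
    using N[of x] by algebra
  then have s: "s x = 0" for x
    by (intro discriminant_not_square[where f = "\<lambda>x. 2 * cmA x * r x - cmB x * s x"])
      (auto intro!: poly_fun_intros cm_poly_fun rp)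
  then have "cmA x * (r x)\<^sup>2 = 0" for x using N[of x] by simp
  then have "r x = 0" if "cmA x \<noteq> 0" for x using that by (metis mult_eq_0_iff power2_eq_square)
  then have "r x = 0" for x
    using poly_fun_cancel[OF cm_poly_fun(1) rp(1) cmA_nonzero] by blast
  with s show ?thesis by simp
qed

text \<open>Multiplying R by its conjugates turns R S = 0 on \<open>L24\<close> into N S = 0 with N
  free of the last coordinate, so N = 0 or S = 0 identically. The real work is that N = 0 forces R =
  0, which is where the two non-squares enter.\<close>

lemma L24_prime:
  assumes f: "f \<in> poly_fun" and g: "g \<in> poly_fun" and fg: "\<And>x. x \<in> L24 \<Longrightarrow> f x * g x = 0"
  shows "(\<forall>x\<in>L24. f x = 0) \<or> (\<forall>x\<in>L24. g x = 0)"
proof -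
  obtain k h r0 r1 r2 r3 where
    r: "h \<in> poly_fun" "r0 \<in> last_free" "r1 \<in> last_free" "r2 \<in> last_free" "r3 \<in> last_free"
      "\<And>x. cmA x ^ k * f x
        = cmF x * h x + (r0 x + r1 x * x $ 6 + r2 x * (x $ 6)\<^sup>2 + r3 x * (x $ 6) ^ 3)"
    using cm_division[OF f] by blast
  obtain k' h' s0 s1 s2 s3 where
    s: "h' \<in> poly_fun" "s0 \<in> last_free" "s1 \<in> last_free" "s2 \<in> last_free" "s3 \<in> last_free"
      "\<And>x. cmA x ^ k' * g x
        = cmF x * h' x + (s0 x + s1 x * x $ 6 + s2 x * (x $ 6)\<^sup>2 + s3 x * (x $ 6) ^ 3)"
    using cm_division[OF g] by blast
  define R where "R = (\<lambda>x. r0 x + r1 x * x $ 6 + r2 x * (x $ 6)\<^sup>2 + r3 x * (x $ 6) ^ 3)"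
  define S where "S = (\<lambda>x. s0 x + s1 x * x $ 6 + s2 x * (x $ 6)\<^sup>2 + s3 x * (x $ 6) ^ 3)"
  have RS: "R x * S x = 0" if "x \<in> L24" for x
  proof -
    have "R x * S x = (cmA x ^ k * f x) * (cmA x ^ k' * g x)"
      using that r(6)[of x] s(6)[of x] by (simp add: L24_eq R_def S_def)
    also have "\<dots> = cmA x ^ k * cmA x ^ k' * (f x * g x)" by (simp add: algebra_simps)
    finally show ?thesis using fg[OF that] by simp
  qed
  have zero: "\<forall>x\<in>L24. g x = 0" if "g \<in> poly_fun" "h \<in> poly_fun" "\<And>x. cmA x ^ k * g x = cmF x * h x" for g h k
    using cmF_strip[OF that] by (auto simp: L24_eq)
  \<comment> \<open>\<open>N\<close> is, up to powers of \<open>cmA\<close>, the norm of the remainder \<open>R\<close> down to the rational functions in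
    the first five coordinates, taken in two quadratic steps through the square of the last one.\<close>
  define c0 where "c0 = (\<lambda>x. (cmA x)\<^sup>2 * (r0 x)\<^sup>2 - cmA x * cmC x * ((r2 x)\<^sup>2 - 2 * r1 x * r3 x)
      - cmB x * cmC x * (r3 x)\<^sup>2)"
  define c1 where "c1 = (\<lambda>x. (cmA x)\<^sup>2 * (2 * r0 x * r2 x - (r1 x)\<^sup>2)
      - cmA x * cmB x * ((r2 x)\<^sup>2 - 2 * r1 x * r3 x) - ((cmB x)\<^sup>2 - cmA x * cmC x) * (r3 x)\<^sup>2)"
  define N where "N = (\<lambda>x. cmA x * (c0 x)\<^sup>2 - cmB x * c0 x * c1 x + cmC x * (c1 x)\<^sup>2)"
  have c: "c0 \<in> last_free" "c1 \<in> last_free"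
    unfolding c0_def c1_def by (intro last_free_intros r)+
  have N: "N \<in> last_free" unfolding N_def by (intro last_free_intros c)
  \<comment> \<open>The conjugate of \<open>R\<close> under y -> -y.\<close>
  define Q where "Q = (\<lambda>x. r0 x + r2 x * (x $ 6)\<^sup>2 - (r1 x + r3 x * (x $ 6)\<^sup>2) * x $ 6)"
  have norm1: "(cmA x)\<^sup>2 * (R x * Q x) = c0 x + c1 x * (x $ 6)\<^sup>2" if "x \<in> L24" for x
  proof -
    have "cmA x * (x $ 6) ^ 4 + cmB x * (x $ 6)\<^sup>2 + cmC x = 0"
      using that by (simp add: L24_eq cmF_def)
    then show ?thesis unfolding R_def Q_def c0_def c1_def by algebra
  qed
  \<comment> \<open>The second factor is A (c0 + c1 z') for the other root z' = - B / A - z, with z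
    the square of the last coordinate.\<close>
  have norm2: "(c0 x + c1 x * (x $ 6)\<^sup>2) * (cmA x * c0 x - cmB x * c1 x - cmA x * c1 x * (x $ 6)\<^sup>2) = N x"
    if "x \<in> L24" for x
  proof -
    have "cmA x * (x $ 6) ^ 4 + cmB x * (x $ 6)\<^sup>2 + cmC x = 0"
      using that by (simp add: L24_eq cmF_def)
    then show ?thesis unfolding N_def by algebra
  qed
  have NS: "N x * S x = 0" if "x \<in> L24" for x
  proof -
    have "N x * S x = (cmA x)\<^sup>2 * Q x
        * (cmA x * c0 x - cmB x * c1 x - cmA x * c1 x * (x $ 6)\<^sup>2) * (R x * S x)"
      unfolding norm2[OF that, symmetric] norm1[OF that, symmetric] by (simp only: ac_simps)
    then show ?thesis using RS[OF that] by simp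
  qed
  have "N x * s0 x = 0 \<and> N x * s1 x = 0 \<and> N x * s2 x = 0 \<and> N x * s3 x = 0" for x
    by (rule cubic_remainder_vanishes[of "\<lambda>x. N x * s0 x" "\<lambda>x. N x * s1 x" "\<lambda>x. N x * s2 x" "\<lambda>x. N x * s3 x"])
      (use NS in \<open>auto intro!: last_free_ops N s(2-5) simp: S_def algebra_simps\<close>)
  then have dom: "(\<forall>x. N x = 0) \<or> (\<forall>x. s x = 0)" if "s \<in> {s0, s1, s2, s3}" for s
    using that poly_fun_domain[OF N[THEN last_free_poly_fun], of s] s(2-5)[THEN last_free_poly_fun] by blast
  show ?thesis
  proof (cases "\<forall>x. N x = 0")
    case False
    then have "s0 x = 0" "s1 x = 0" "s2 x = 0" "s3 x = 0" for x using dom by blast+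
    then show ?thesis using zero[OF g s(1), of k'] s(6) by simp
  next
    case True
    then have c_zero: "c0 x = 0" "c1 x = 0" for x
      using last_free_norm_nonzero[OF c] unfolding N_def by blast+
    \<comment> \<open>Vanishing of \<open>c0\<close> and \<open>c1\<close> says that (r0 + r2 z)^2 =
      z (r1 + r3 z)^2 for both roots z. \<open>NP\<close> and \<open>NQ\<close> are A times the
      norms of the two linear expressions, and multiplying the equations for both roots, whose
      product is C / A, gives \<open>key\<close>.\<close>
    define NP where "NP = (\<lambda>x. cmA x * (r0 x)\<^sup>2 - cmB x * r0 x * r2 x + cmC x * (r2 x)\<^sup>2)"
    define NQ where "NQ = (\<lambda>x. cmA x * (r1 x)\<^sup>2 - cmB x * r1 x * r3 x + cmC x * (r3 x)\<^sup>2)"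
    have NPQ: "NP \<in> last_free" "NQ \<in> last_free"
      unfolding NP_def NQ_def by (intro last_free_intros r)+
    have key: "cmA x * (NP x)\<^sup>2 - cmC x * (NQ x)\<^sup>2 = 0" for x
    proof (rule poly_fun_cancel[OF cm_poly_fun(1)])
      show "(\<lambda>x. cmA x * (NP x)\<^sup>2 - cmC x * (NQ x)\<^sup>2) \<in> poly_fun"
        by (intro poly_fun_intros cm_poly_fun NPQ[THEN last_free_poly_fun])
      show "cmA (vec6 1 0 0 0 0 0) \<noteq> 0" by (rule cmA_nonzero)
      fix x assume A: "cmA x \<noteq> 0"
      define \<delta> where "\<delta> = csqrt ((cmB x)\<^sup>2 - 4 * cmA x * cmC x)"
      have \<delta>2: "\<delta>\<^sup>2 = (cmB x)\<^sup>2 - 4 * cmA x * cmC x" by (simp add: \<delta>_def)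
      define z where "z = (- cmB x + \<delta>) / (2 * cmA x)"
      define z' where "z' = (- cmB x - \<delta>) / (2 * cmA x)"
      have z: "2 * cmA x * z = - cmB x + \<delta>" "2 * cmA x * z' = - cmB x - \<delta>"
        using A by (simp_all add: z_def z'_def)
      have "2 * (cmA x * (z + z') + cmB x) = 0" using z by algebra
      then have "cmA x * (z + z') + cmB x = 0" unfolding mult_eq_0_iff by simp
      then have B: "cmB x = - cmA x * (z + z')" by algebra
      have "4 * cmA x * (cmA x * (z * z') - cmC x) = 0" using z \<delta>2 by algebra
      then have C: "cmC x = cmA x * (z * z')" using A by simp
      have P: "(r0 x + r2 x * w)\<^sup>2 = w * (r1 x + r3 x * w)\<^sup>2" if w: "w = z \<or> w = z'" for w
      proof -
        have "cmA x * w\<^sup>2 + cmB x * w + cmC x = 0" using w unfolding B C by (auto simp: algebra_simps power2_eq_square)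
        then have "(cmA x)\<^sup>2 * ((r0 x + r2 x * w)\<^sup>2 - w * (r1 x + r3 x * w)\<^sup>2) = c0 x + c1 x * w"
          unfolding c0_def c1_def by algebra
        then show ?thesis using A c_zero by simp
      qed
      have "NP x = cmA x * ((r0 x + r2 x * z) * (r0 x + r2 x * z'))"
        unfolding NP_def B C by algebra
      then have "(NP x)\<^sup>2 = (cmA x)\<^sup>2 * ((r0 x + r2 x * z)\<^sup>2 * (r0 x + r2 x * z')\<^sup>2)"
        by (simp add: power_mult_distrib)
      also have "\<dots> = (cmA x)\<^sup>2 * (z * (r1 x + r3 x * z)\<^sup>2 * (z' * (r1 x + r3 x * z')\<^sup>2))"
        using P by simp
      also have "\<dots> = z * z' * (cmA x * ((r1 x + r3 x * z) * (r1 x + r3 x * z')))\<^sup>2"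
        by algebra
      also have "cmA x * ((r1 x + r3 x * z) * (r1 x + r3 x * z')) = NQ x"
        unfolding NQ_def B C by algebra
      finally show "cmA x * (NP x)\<^sup>2 - cmC x * (NQ x)\<^sup>2 = 0" using C by simp
    qed
    \<comment> \<open>One more factor A = -2 l12^2 turns \<open>key\<close> into an equation between
      a square and -2 C times a square.\<close>
    have "(cmA x * NP x)\<^sup>2 = - 2 * cmC x * (x $ 1 * NQ x)\<^sup>2" for x
    proof -
      have "(cmA x * NP x)\<^sup>2 = cmA x * (cmA x * (NP x)\<^sup>2)" by algebra
      also have "\<dots> = cmA x * (cmC x * (NQ x)\<^sup>2)" using key[of x] by simp
      finally show ?thesis unfolding cmA_def by algebra
    qed
    then have "x $ 1 * NQ x = 0" for x
      by (intro cmC_not_square[where f = "\<lambda>x. cmA x * NP x" and g = "\<lambda>x. x $ 1 * NQ x"])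
        (auto intro!: poly_fun_intros cm_poly_fun NPQ[THEN last_free_poly_fun])
    then have "NQ x = 0" if "x $ 1 \<noteq> 0" for x using that by (metis mult_eq_0_iff)
    then have NQ0: "NQ x = 0" for x
      using poly_fun_cancel[OF poly_fun.var[of 1] NPQ(2)[THEN last_free_poly_fun], of "vec6 1 0 0 0 0 0"]
      by simp
    then have "NP x = 0" if "cmA x \<noteq> 0" for x using that key[of x] by simp
    then have NP0: "NP x = 0" for x
      using poly_fun_cancel[OF cm_poly_fun(1) NPQ(1)[THEN last_free_poly_fun] cmA_nonzero] by blast
    have "r0 x = 0" "r1 x = 0" "r2 x = 0" "r3 x = 0" for x
      using last_free_norm_nonzero[OF r(2,4)] last_free_norm_nonzero[OF r(3,5)] NP0 NQ0
      unfolding NP_def NQ_def by blast+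
    then show ?thesis using zero[OF f r(1), of k] r(6) by simp
  qed
qed

lemma irreducible_closed_L24: "irreducible_closed L24"
  unfolding irreducible_closed_iff_prime
proof (intro conjI ballI impI)
  show "zariski_closed L24" unfolding L24_eq by (rule zariski_closed_zeros[OF cm_poly_fun(4)])
  have "0 \<in> L24" by (simp add: L24_eq cmF_def cmA_def cmB_def cmC_def)
  then show "L24 \<noteq> {}" by blast
qed (use L24_prime in blast)

section \<open>Chains of irreducible closed sets have length at most six\<close>

definition fun_scale :: "complex \<Rightarrow> (complex ^ 6 \<Rightarrow> complex) \<Rightarrow> complex ^ 6 \<Rightarrow> complex" where
  "fun_scale c f = (\<lambda>x. c * f x)"

interpretation cfun: vector_space fun_scale
  by unfold_locales (auto simp: fun_scale_def fun_eq_iff algebra_simps)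

lemma sum_fun_apply: "(\<Sum>i\<in>I. f i) x = (\<Sum>i\<in>I. f i x :: complex)"
  by (induction I rule: infinite_finite_induct) auto

text \<open>Independence refers to the indexed family, so two equal members would already give a
  relation; hence \<open>b\<close> is injective and the exchange bound for sets applies.\<close>

lemma card_le_if_indep_in_span:
  fixes b :: "'i \<Rightarrow> complex ^ 6 \<Rightarrow> complex"
  assumes "finite I" "finite M" and span: "\<And>i. i \<in> I \<Longrightarrow> b i \<in> cfun.span M"
    and indep: "\<And>k. (\<And>x. (\<Sum>i\<in>I. k i * b i x) = 0) \<Longrightarrow> \<forall>i\<in>I. k i = 0"
  shows "card I \<le> card M"
proof -
  have inj: "inj_on b I"
  proof (rule inj_onI, rule ccontr)
    fix i j assume ij: "i \<in> I" "j \<in> I" "b i = b j" "i \<noteq> j"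
    define k :: "'i \<Rightarrow> complex" where "k = (\<lambda>l. of_bool (l = i) - of_bool (l = j))"
    have "(\<Sum>l\<in>I. k l * b l x) = 0" for x
    proof -
      have "(\<Sum>l\<in>I. k l * b l x) = (\<Sum>l\<in>I. of_bool (l = i) * b l x) - (\<Sum>l\<in>I. of_bool (l = j) * b l x)"
        by (simp add: k_def left_diff_distrib sum_subtractf)
      also have "\<dots> = b i x - b j x"
        using assms(1) ij(1,2) by (simp add: of_bool_def if_distrib[of "\<lambda>c. c * _"] sum.delta cong: if_cong)
      finally show ?thesis using ij(3) by simp
    qed
    then have "k i = 0" using indep ij(1) by blast
    then show False using ij(4) by (simp add: k_def)
  qed
  have "cfun.independent (b ` I)"
  proof (rule cfun.independent_if_scalars_zero)
    show "finite (b ` I)" using assms(1) by simp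
    fix k f assume k: "(\<Sum>x\<in>b ` I. fun_scale (k x) x) = 0" and f: "f \<in> b ` I"
    have "(\<Sum>i\<in>I. k (b i) * b i x) = 0" for x
      using fun_cong[OF k, of x] inj by (simp add: sum.reindex sum_fun_apply fun_scale_def)
    then have "\<forall>i\<in>I. k (b i) = 0" using indep[of "\<lambda>i. k (b i)"] by blast
    then show "k f = 0" using f by blast
  qed
  then have "card (b ` I) \<le> card M"
    using cfun.independent_span_bound[OF assms(2)] span by blast
  then show ?thesis using inj by (simp add: card_image)
qed

text \<open>Exponents are bounded separately in each variable: such boxes are counted by a plain
  sixth power, and their bounds add under multiplication.\<close>

definition box_monomials :: "nat \<Rightarrow> (complex ^ 6 \<Rightarrow> complex) set" where
  "box_monomials d = (\<lambda>e x. \<Prod>i\<in>UNIV. x $ i ^ e i) ` (UNIV \<rightarrow>\<^sub>E {..d})"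

lemma finite_box_monomials: "finite (box_monomials d)"
  unfolding box_monomials_def by (intro finite_imageI finite_PiE) auto

lemma card_box_monomials: "card (box_monomials d) \<le> Suc d ^ 6"
proof -
  have "card (box_monomials d) \<le> card (UNIV \<rightarrow>\<^sub>E {..d} :: (6 \<Rightarrow> nat) set)"
    unfolding box_monomials_def by (intro card_image_le finite_PiE) auto
  then show ?thesis by (simp add: card_PiE)
qed

lemma box_span_mono: "d \<le> d' \<Longrightarrow> cfun.span (box_monomials d) \<subseteq> cfun.span (box_monomials d')"
  unfolding box_monomials_def by (intro cfun.span_mono image_mono PiE_mono) auto

lemma box_span_mult:
  assumes f: "f \<in> cfun.span (box_monomials a)" and g: "g \<in> cfun.span (box_monomials b)"
  shows "(\<lambda>x. f x * g x) \<in> cfun.span (box_monomials (a + b))"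
proof -
  have monomials: "(\<lambda>x. p x * q x) \<in> cfun.span (box_monomials (a + b))"
    if p: "p \<in> box_monomials a" and q: "q \<in> box_monomials b" for p q
  proof -
    obtain e where e: "e \<in> UNIV \<rightarrow>\<^sub>E {..a}" "p = (\<lambda>x. \<Prod>i\<in>UNIV. x $ i ^ e i)"
      using p unfolding box_monomials_def by blast
    obtain e' where e': "e' \<in> UNIV \<rightarrow>\<^sub>E {..b}" "q = (\<lambda>x. \<Prod>i\<in>UNIV. x $ i ^ e' i)"
      using q unfolding box_monomials_def by blast
    have "(\<lambda>x. p x * q x) = (\<lambda>x. \<Prod>i\<in>UNIV. x $ i ^ (e i + e' i))"
      unfolding e e' by (simp add: power_add prod.distrib)
    moreover have "(\<lambda>i. e i + e' i) \<in> UNIV \<rightarrow>\<^sub>E {..a + b}"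
      using e(1) e'(1) by (auto simp: PiE_iff intro: add_mono)
    ultimately show ?thesis unfolding box_monomials_def by (intro cfun.span_base image_eqI)
  qed
  have left: "(\<lambda>x. p x * g x) \<in> cfun.span (box_monomials (a + b))" if p: "p \<in> box_monomials a" for p
    using g
  proof (induction rule: cfun.span_induct_alt)
    case base
    have "(\<lambda>x. p x * 0 x) = (0 :: complex ^ 6 \<Rightarrow> complex)" by (simp add: fun_eq_iff)
    then show ?case by (simp add: cfun.span_zero)
  next
    case (step c q y)
    have "(\<lambda>x. p x * (fun_scale c q + y) x) = fun_scale c (\<lambda>x. p x * q x) + (\<lambda>x. p x * y x)"
      by (simp add: fun_eq_iff fun_scale_def algebra_simps)
    then show ?case using step monomials[OF p] by (simp add: cfun.span_add cfun.span_scale)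
  qed
  show ?thesis
    using f
  proof (induction rule: cfun.span_induct_alt)
    case base
    have "(\<lambda>x. 0 x * g x) = (0 :: complex ^ 6 \<Rightarrow> complex)" by (simp add: fun_eq_iff)
    then show ?case by (simp add: cfun.span_zero)
  next
    case (step c q y)
    have "(\<lambda>x. (fun_scale c q + y) x * g x) = fun_scale c (\<lambda>x. q x * g x) + (\<lambda>x. y x * g x)"
      by (simp add: fun_eq_iff fun_scale_def algebra_simps)
    then show ?case using step left by (simp add: cfun.span_add cfun.span_scale)
  qed
qed

lemma one_in_box_span: "(\<lambda>x. 1) \<in> cfun.span (box_monomials d)"
proof (rule cfun.span_base)
  show "(\<lambda>x. 1) \<in> box_monomials d"
    unfolding box_monomials_def by (rule image_eqI[of _ _ "\<lambda>i. 0"]) auto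
qed

lemma box_span_power:
  assumes "f \<in> cfun.span (box_monomials d)" "j \<le> N"
  shows "(\<lambda>x. f x ^ j) \<in> cfun.span (box_monomials (N * d))"
proof -
  have "(\<lambda>x. f x ^ j) \<in> cfun.span (box_monomials (j * d))"
  proof (induction j)
    case (Suc j)
    then show ?case using box_span_mult[OF assms(1)] by simp
  qed (simp add: one_in_box_span)
  then show ?thesis using box_span_mono[of "j * d" "N * d"] assms(2) by auto
qed

lemma poly_fun_in_box_span: "f \<in> poly_fun \<Longrightarrow> \<exists>d. f \<in> cfun.span (box_monomials d)"
proof (induction rule: poly_fun.induct)
  case (const c)
  have "(\<lambda>x. c) = fun_scale c (\<lambda>x. 1)" by (simp add: fun_scale_def)
  then show ?case using one_in_box_span cfun.span_scale by metis
next
  case (var i)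
  have "(\<lambda>x. x $ i) \<in> box_monomials 1"
    unfolding box_monomials_def
  proof (rule image_eqI)
    show "(\<lambda>x. x $ i) = (\<lambda>x :: complex ^ 6. \<Prod>j\<in>UNIV. x $ j ^ (if j = i then 1 else 0))"
      by (simp add: fun_eq_iff if_distrib prod.delta cong: if_cong)
  qed auto
  then show ?case using cfun.span_base by blast
next
  case (add f g)
  then obtain a b where "f \<in> cfun.span (box_monomials a)" "g \<in> cfun.span (box_monomials b)" by blast
  then have "f \<in> cfun.span (box_monomials (a + b))" "g \<in> cfun.span (box_monomials (a + b))"
    using box_span_mono[of a "a + b"] box_span_mono[of b "a + b"] by auto
  then have "f + g \<in> cfun.span (box_monomials (a + b))" by (rule cfun.span_add)
  moreover have "f + g = (\<lambda>x. f x + g x)" by (simp add: fun_eq_iff)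
  ultimately show ?case by metis
next
  case (mult f g)
  then show ?case using box_span_mult by blast
qed

text \<open>The head of the list is the exponent of the factor with the largest index, so that
  removing it matches removing the top member of a chain.\<close>

primrec power_product :: "(nat \<Rightarrow> complex ^ 6 \<Rightarrow> complex) \<Rightarrow> nat list \<Rightarrow> complex ^ 6 \<Rightarrow> complex" where
  "power_product f [] = (\<lambda>x. 1)"
| "power_product f (j # js) = (\<lambda>x. f (length js) x ^ j * power_product f js x)"

definition exponent_lists :: "nat \<Rightarrow> nat \<Rightarrow> nat list set" where
  "exponent_lists N m = {js. set js \<subseteq> {..N} \<and> length js = m}"

lemma finite_exponent_lists: "finite (exponent_lists N m)"
  unfolding exponent_lists_def by (rule finite_lists_length_eq) simp

lemma card_exponent_lists: "card (exponent_lists N m) = Suc N ^ m"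
  unfolding exponent_lists_def by (simp add: card_lists_length_eq)

lemma exponent_lists_0: "exponent_lists N 0 = {[]}"
  by (auto simp: exponent_lists_def)

lemma exponent_lists_Suc:
  "exponent_lists N (Suc m) = (\<lambda>(j, js). j # js) ` ({..N} \<times> exponent_lists N m)"
  unfolding exponent_lists_def by (auto simp: length_Suc_conv)

lemma sum_exponent_lists_Suc:
  "(\<Sum>js\<in>exponent_lists N (Suc m). F js) = (\<Sum>j\<le>N. \<Sum>js\<in>exponent_lists N m. F (j # js))"
proof -
  have "inj_on (\<lambda>(j, js). j # js) ({..N} \<times> exponent_lists N m)" by (auto simp: inj_on_def)
  then show ?thesis
    unfolding exponent_lists_Suc by (simp add: sum.reindex sum.cartesian_product case_prod_unfold)
qed

lemma power_product_poly_fun: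
  "(\<And>i. i < length js \<Longrightarrow> f i \<in> poly_fun) \<Longrightarrow> power_product f js \<in> poly_fun"
  by (induction js) (auto intro!: poly_fun_intros)

lemma power_product_box_span:
  assumes "\<And>i. i < m \<Longrightarrow> f i \<in> cfun.span (box_monomials d)" "js \<in> exponent_lists N m"
  shows "power_product f js \<in> cfun.span (box_monomials (m * (N * d)))"
  using assms
proof (induction m arbitrary: js)
  case 0
  then show ?case by (simp add: exponent_lists_0 one_in_box_span)
next
  case (Suc m)
  then obtain j ks where js: "js = j # ks" "j \<le> N" "ks \<in> exponent_lists N m"
    by (auto simp: exponent_lists_Suc)
  then have "length ks = m" by (simp add: exponent_lists_def)
  moreover have "(\<lambda>x. f m x ^ j * power_product f ks x) \<in> cfun.span (box_monomials (N * d + m * (N * d)))"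
    by (intro box_span_mult box_span_power Suc js) auto
  ultimately show ?case unfolding js(1) by simp
qed

text \<open>On \<open>Y\<close> only the constant term of the sum in powers of f survives. The
  assumption that coefficients vanishing on \<open>Y\<close> vanish identically removes it from all
  of \<open>Z\<close>; then primality of \<open>Z\<close> cancels one factor f, and the degree
  drops.\<close>

lemma power_sum_coefficients_vanish:
  assumes Z: "irreducible_closed Z" and "Y \<subseteq> Z" and f: "f \<in> poly_fun"
    and fY: "\<And>x. x \<in> Y \<Longrightarrow> f x = 0" and fZ: "\<exists>x\<in>Z. f x \<noteq> 0"
    and "\<And>j. S j \<in> poly_fun"
    and "\<And>j. (\<And>x. x \<in> Y \<Longrightarrow> S j x = 0) \<Longrightarrow> (\<And>x. S j x = 0)"
    and "\<And>x. x \<in> Z \<Longrightarrow> (\<Sum>j\<le>N. f x ^ j * S j x) = 0"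
  shows "\<forall>j\<le>N. \<forall>x\<in>Y. S j x = 0"
  using assms(6-8)
proof (induction N arbitrary: S)
  case 0
  then show ?case using \<open>Y \<subseteq> Z\<close> by auto
next
  case (Suc N)
  have split: "(\<Sum>j\<le>Suc N. f x ^ j * S j x) = S 0 x + f x * (\<Sum>j\<le>N. f x ^ j * S (Suc j) x)" for x
    by (simp add: sum.atMost_Suc_shift sum_distrib_left mult.assoc del: sum.atMost_Suc)
  have "S 0 x = 0" if "x \<in> Y" for x
    using Suc.prems(3)[of x] split[of x] fY[OF that] that \<open>Y \<subseteq> Z\<close> by auto
  then have S0: "S 0 x = 0" for x using Suc.prems(2) by blast
  have "\<forall>x\<in>Z. f x * (\<Sum>j\<le>N. f x ^ j * S (Suc j) x) = 0"
    using Suc.prems(3) split S0 by simp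
  moreover have "(\<lambda>x. \<Sum>j\<le>N. f x ^ j * S (Suc j) x) \<in> poly_fun"
    by (intro poly_fun_intros f Suc.prems)
  ultimately have "\<forall>x\<in>Z. (\<Sum>j\<le>N. f x ^ j * S (Suc j) x) = 0"
    using conjunct2[OF conjunct2[OF Z[unfolded irreducible_closed_iff_prime]], rule_format, OF f] fZ
    by blast
  then have "\<forall>j\<le>N. \<forall>x\<in>Y. S (Suc j) x = 0"
    by (intro Suc.IH[of "\<lambda>j. S (Suc j)"]) (use Suc.prems in blast)+
  then show ?case using S0 by (metis Suc_le_mono not0_implies_Suc)
qed

text \<open>Sort a relation by powers of the top polynomial. Independence of the lower products on
  \<open>c m\<close> is exactly what makes coefficients vanishing there vanish identically.\<close>

lemma chain_power_products_independent:
  assumes irr: "\<And>i. i \<le> m \<Longrightarrow> irreducible_closed (c i)"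
    and sub: "\<And>i. i < m \<Longrightarrow> c i \<subseteq> c (Suc i)"
    and f: "\<And>i. i < m \<Longrightarrow> f i \<in> poly_fun"
    and f0: "\<And>i x. i < m \<Longrightarrow> x \<in> c i \<Longrightarrow> f i x = 0"
    and f1: "\<And>i. i < m \<Longrightarrow> \<exists>x\<in>c (Suc i). f i x \<noteq> 0"
    and zero: "\<And>x. x \<in> c m \<Longrightarrow> (\<Sum>js\<in>exponent_lists N m. k js * power_product f js x) = 0"
  shows "\<forall>js\<in>exponent_lists N m. k js = 0"
  using assms
proof (induction m arbitrary: k)
  case 0
  obtain x where "x \<in> c 0" using 0(1)[of 0] unfolding irreducible_closed_def by auto
  then show ?case using 0(6)[of x] by (simp add: exponent_lists_0)
next
  case (Suc m)
  \<comment> \<open>The value 0 beyond \<open>N\<close> lets the requirements on the coefficients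
    hold for every index.\<close>
  define S where "S = (\<lambda>j x. if j \<le> N then \<Sum>js\<in>exponent_lists N m. k (j # js) * power_product f js x else 0)"
  have IH: "\<forall>js\<in>exponent_lists N m. k' js = 0"
    if "\<And>x. x \<in> c m \<Longrightarrow> (\<Sum>js\<in>exponent_lists N m. k' js * power_product f js x) = 0" for k'
    by (rule Suc.IH) (use Suc.prems that in auto)
  have "\<forall>j\<le>N. \<forall>x\<in>c m. S j x = 0"
  proof (rule power_sum_coefficients_vanish)
    show "irreducible_closed (c (Suc m))" "c m \<subseteq> c (Suc m)" "f m \<in> poly_fun"
      "\<exists>x\<in>c (Suc m). f m x \<noteq> 0" "\<And>x. x \<in> c m \<Longrightarrow> f m x = 0"
      using Suc.prems by auto
    show "S j \<in> poly_fun" for j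
    proof (cases "j \<le> N")
      case True
      have "power_product f js \<in> poly_fun" if "js \<in> exponent_lists N m" for js
        using that Suc.prems(3) by (intro power_product_poly_fun) (auto simp: exponent_lists_def)
      then show ?thesis using True unfolding S_def by (auto intro!: poly_fun_intros)
    qed (auto simp: S_def intro: poly_fun_intros)
    show "S j x = 0" if "\<And>x. x \<in> c m \<Longrightarrow> S j x = 0" for j x
    proof (cases "j \<le> N")
      case True
      then have "\<forall>js\<in>exponent_lists N m. k (j # js) = 0"
        using that by (intro IH) (auto simp: S_def)
      then show ?thesis by (simp add: S_def)
    qed (simp add: S_def)
    fix x assume x: "x \<in> c (Suc m)"
    have "(\<Sum>j\<le>N. f m x ^ j * S j x)
        = (\<Sum>j\<le>N. \<Sum>js\<in>exponent_lists N m. k (j # js) * power_product f (j # js) x)"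
    proof (rule sum.cong[OF refl])
      fix j assume "j \<in> {..N}"
      then show "f m x ^ j * S j x = (\<Sum>js\<in>exponent_lists N m. k (j # js) * power_product f (j # js) x)"
        by (auto simp: S_def sum_distrib_left exponent_lists_def algebra_simps intro!: sum.cong)
    qed
    also have "\<dots> = 0"
      using Suc.prems(6)[OF x] by (simp only: sum_exponent_lists_Suc)
    finally show "(\<Sum>j\<le>N. f m x ^ j * S j x) = 0" .
  qed
  then have "\<forall>js\<in>exponent_lists N m. k (j # js) = 0" if "j \<le> N" for j
    using that by (intro IH) (auto simp: S_def)
  then show ?case by (auto simp: exponent_lists_Suc)
qed

text \<open>There are (N+1)^n independent products in a space of dimension at most (n N d + 1)^6,
  which grows only like N^6; n = 7 or more is impossible for large N.\<close>

lemma chain_length_le_6: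
  assumes irr: "\<And>i. i \<le> n \<Longrightarrow> irreducible_closed (c i)" and sub: "\<And>i. i < n \<Longrightarrow> c i \<subset> c (Suc i)"
  shows "n \<le> 6"
proof (rule ccontr)
  assume "\<not> n \<le> 6"
  have "\<exists>g\<in>poly_fun. (\<forall>x\<in>c i. g x = 0) \<and> (\<exists>x\<in>c (Suc i). g x \<noteq> 0)" if i: "i < n" for i
  proof -
    have "zariski_closed (c i)" using irr[of i] i by (simp add: irreducible_closed_def)
    then obtain F where F: "F \<subseteq> poly_fun" "c i = {x. \<forall>f\<in>F. f x = 0}"
      unfolding zariski_closed_def by blast
    obtain x where "x \<in> c (Suc i)" "x \<notin> c i" using sub[OF i] by blast
    moreover from this obtain g where "g \<in> F" "g x \<noteq> 0" using F(2) by auto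
    ultimately show ?thesis using F by (intro bexI[of _ g]) auto
  qed
  then obtain f where f: "\<And>i. i < n \<Longrightarrow> f i \<in> poly_fun" "\<And>i x. i < n \<Longrightarrow> x \<in> c i \<Longrightarrow> f i x = 0"
      "\<And>i. i < n \<Longrightarrow> \<exists>x\<in>c (Suc i). f i x \<noteq> 0"
    by metis
  have "\<forall>i. \<exists>d. i < n \<longrightarrow> f i \<in> cfun.span (box_monomials d)"
    using poly_fun_in_box_span f(1) by blast
  then obtain d' where d': "\<And>i. i < n \<Longrightarrow> f i \<in> cfun.span (box_monomials (d' i))" by metis
  define d where "d = (\<Sum>i<n. d' i)"
  have d: "f i \<in> cfun.span (box_monomials d)" if "i < n" for i
  proof -
    have "d' i \<le> d" unfolding d_def using that by (intro member_le_sum) auto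
    then show ?thesis using d'[OF that] box_span_mono by blast
  qed
  have bound: "Suc N ^ n \<le> Suc (n * (N * d)) ^ 6" for N
  proof -
    have "card (exponent_lists N n) \<le> card (box_monomials (n * (N * d)))"
    proof (rule card_le_if_indep_in_span)
      show "finite (exponent_lists N n)" by (rule finite_exponent_lists)
      show "finite (box_monomials (n * (N * d)))" by (rule finite_box_monomials)
      show "power_product f js \<in> cfun.span (box_monomials (n * (N * d)))" if "js \<in> exponent_lists N n" for js
        using power_product_box_span[OF d that] .
      show "\<forall>js\<in>exponent_lists N n. k js = 0"
        if "\<And>x. (\<Sum>js\<in>exponent_lists N n. k js * power_product f js x) = 0" for k
        by (rule chain_power_products_independent[where c = c and f = f])
          (use irr sub f that in auto)
    qed
    then show ?thesis using card_box_monomials[of "n * (N * d)"] by (simp add: card_exponent_lists)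
  qed
  \<comment> \<open>Since n N d + 1 <= (n d + 1)(N + 1), this choice bounds the dimension by N
    (N+1)^6, just below (N+1)^7.\<close>
  define N where "N = Suc (n * d) ^ 6"
  have "Suc N ^ 7 \<le> Suc N ^ n" using \<open>\<not> n \<le> 6\<close> by (intro power_increasing) auto
  also have "\<dots> \<le> Suc (n * (N * d)) ^ 6" by (rule bound)
  also have "\<dots> \<le> (Suc (n * d) * Suc N) ^ 6" by (intro power_mono) (auto simp: algebra_simps)
  also have "\<dots> = N * Suc N ^ 6" unfolding power_mult_distrib N_def ..
  finally have "Suc N * Suc N ^ 6 \<le> N * Suc N ^ 6" by (simp add: eval_nat_numeral)
  then show False by simp
qed

text \<open>The whole space is irreducible, so a chain ending strictly below it can be prolonged by
  one.\<close>

lemma chain_length_le_5: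
  assumes irr: "\<And>i. i \<le> n \<Longrightarrow> irreducible_closed (c i)" and sub: "\<And>i. i < n \<Longrightarrow> c i \<subset> c (Suc i)"
    and "c n \<noteq> UNIV"
  shows "n \<le> 5"
proof -
  have "Suc n \<le> 6"
  proof (rule chain_length_le_6)
    show "irreducible_closed ((c(Suc n := UNIV)) i)" if "i \<le> Suc n" for i
      using irr irreducible_closed_UNIV that by auto
    show "(c(Suc n := UNIV)) i \<subset> (c(Suc n := UNIV)) (Suc i)" if "i < Suc n" for i
      using sub \<open>c n \<noteq> UNIV\<close> that by (cases "i = n") auto
  qed
  then show ?thesis by simp
qed

section \<open>The local dimension of the hypersurface\<close>

lemma zariski_closure_psubset:
  assumes "S \<subseteq> zariski_closure T" "g \<in> poly_fun" "\<And>x. x \<in> S \<Longrightarrow> g x = 0" "y \<in> T" "g y \<noteq> 0"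
  shows "zariski_closure S \<subset> zariski_closure T"
proof -
  have "zariski_closure S \<subseteq> zariski_closure T"
    using zariski_closure_minimal[OF zariski_closed_closure] assms(1) by blast
  moreover have "y \<in> zariski_closure T" using zariski_closure_superset assms(4) by blast
  moreover have "y \<notin> zariski_closure S" using assms unfolding zariski_closure_def by blast
  ultimately show ?thesis by blast
qed

text \<open>If the first three points lie on a line with \<open>l\<^sub>1\<^sub>3 = l\<^sub>1\<^sub>2 + l\<^sub>2\<^sub>3\<close>, the determinant is a
  multiple of the square of the defect in Stewart's theorem. Stewart's equation becomes linear in
  \<open>l\<^sub>2\<^sub>4\<close> after substituting \<open>l\<^sub>1\<^sub>4 = l\<^sub>2\<^sub>4 + s\<close> and \<open>l\<^sub>3\<^sub>4 = l\<^sub>2\<^sub>4 + r\<close>; this yields the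
  polynomial parametrization \<open>stewart_param\<close> of a four-dimensional subset.\<close>

lemma cmF_stewart:
  "cmF (vec6 a (a + b) u b v w) = - 2 * (b * u\<^sup>2 - (a + b) * v\<^sup>2 + a * w\<^sup>2 - a * b * (a + b))\<^sup>2"
  unfolding cmF_def cmA_def cmB_def cmC_def vec6_nth by algebra

definition stewart_param :: "complex \<Rightarrow> complex \<Rightarrow> complex \<Rightarrow> complex \<Rightarrow> complex \<Rightarrow> complex ^ 6" where
  "stewart_param a b s r \<tau> =
    (let L = 2 * (b * s + a * r); M = a * b * (a + b) - b * s\<^sup>2 - a * r\<^sup>2 in
     vec6 (\<tau> * (a * L)) (\<tau> * (a * L) + \<tau> * (b * L)) (\<tau> * (s * L + M)) (\<tau> * (b * L)) (\<tau> * M) (\<tau> * (r * L + M)))"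

text \<open>After the substitution Stewart's equation reads l24 L = M. Multiplying all lengths by L
  clears the denominator, and the equation, being homogeneous, tolerates the further scale
  \<tau>.\<close>

lemma stewart_param_in_L24: "stewart_param a b s r \<tau> \<in> L24"
proof -
  define L where "L = 2 * (b * s + a * r)"
  define M where "M = a * b * (a + b) - b * s\<^sup>2 - a * r\<^sup>2"
  have "(\<tau> * (b * L)) * (\<tau> * (s * L + M))\<^sup>2 - (\<tau> * (a * L) + \<tau> * (b * L)) * (\<tau> * M)\<^sup>2
      + (\<tau> * (a * L)) * (\<tau> * (r * L + M))\<^sup>2
      - (\<tau> * (a * L)) * (\<tau> * (b * L)) * (\<tau> * (a * L) + \<tau> * (b * L))
      = \<tau> ^ 3 * L\<^sup>2 * (L * (b * s\<^sup>2 + a * r\<^sup>2 - a * b * (a + b)) + M * (2 * (b * s + a * r)))"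
    by algebra
  also have "\<dots> = 0" unfolding L_def M_def by algebra
  finally show ?thesis
    unfolding L24_eq stewart_param_def Let_def L_def[symmetric] M_def[symmetric]
    by (simp add: cmF_stewart)
qed

text \<open>Signed distances of the collinear points 0, a, a + b, a - x.\<close>

definition line_param :: "complex \<Rightarrow> complex \<Rightarrow> complex \<Rightarrow> complex ^ 6" where
  "line_param a b x = vec6 a (a + b) (a - x) b x (x + b)"

text \<open>For collinear points s = l14 - l24 = a - 2 x and r = l34 - l24 = b, whence M = x L, and
  the scale 1 / L recovers the configuration. This needs L = 4 b (a - x) nonzero; density supplies
  the remaining points.\<close>

lemma line_param_in_stewart_closure:
  "line_param a b x \<in> zariski_closure (range (\<lambda>t :: complex ^ 6. stewart_param (t $ 1) (t $ 2) (t $ 3) (t $ 4) (t $ 5)))"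
  unfolding zariski_closure_def
proof (intro CollectI ballI impI)
  fix g assume g: "g \<in> poly_fun"
    and *: "\<forall>y\<in>range (\<lambda>t :: complex ^ 6. stewart_param (t $ 1) (t $ 2) (t $ 3) (t $ 4) (t $ 5)). g y = 0"
  have zero: "g (stewart_param a b s r \<tau>) = 0" for a b s r \<tau>
    using *[rule_format, OF rangeI, of "vec6 a b s r \<tau> 0"] by simp
  have "g (line_param (t $ 1) (t $ 2) (t $ 3)) = 0" for t :: "complex ^ 6"
  proof (rule poly_fun_cancel[where f = "\<lambda>t. 4 * t $ 2 * (t $ 1 - t $ 3)" 
        and g = "\<lambda>t. g (line_param (t $ 1) (t $ 2) (t $ 3))" and p = "vec6 1 1 0 0 0 0"])
    show "(\<lambda>t. 4 * t $ 2 * (t $ 1 - t $ 3)) \<in> poly_fun" by (intro poly_fun_intros)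
    show "(\<lambda>t. g (line_param (t $ 1) (t $ 2) (t $ 3))) \<in> poly_fun"
      unfolding line_param_def by (intro poly_fun_compose[OF g] vec6_poly_fun poly_fun_intros)
    show "4 * vec6 1 1 0 0 0 0 $ 2 * (vec6 1 1 0 0 0 0 $ 1 - vec6 1 1 0 0 0 0 $ 3) \<noteq> 0" by simp
    fix t :: "complex ^ 6" assume nz: "4 * t $ 2 * (t $ 1 - t $ 3) \<noteq> 0"
    define a b x where "a = t $ 1" "b = t $ 2" "x = t $ 3"
    define L where "L = 4 * b * (a - x)"
    have nz: "L \<noteq> 0" using nz by (simp add: a_b_x_def L_def)
    have L: "2 * (b * (a - 2 * x) + a * b) = L" by (simp add: L_def algebra_simps)
    have M: "a * b * (a + b) - b * (a - 2 * x)\<^sup>2 - a * b\<^sup>2 = x * L" unfolding L_def by algebra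
    have "stewart_param a b (a - 2 * x) b (1 / L) = line_param a b x"
      unfolding stewart_param_def line_param_def Let_def L M using nz
      by (simp add: vec_eq_iff forall_6 field_simps)
    then show "g (line_param (t $ 1) (t $ 2) (t $ 3)) = 0" using zero by (metis a_b_x_def)
  qed
  from this[of "vec6 a b x 0 0 0"] show "g (line_param a b x) = 0" by simp
qed

text \<open>Dimensions 0 to 5: the origin, collinear configurations with one, two and three
  parameters, the Stewart family, the hypersurface. All but the last are closures of polynomial
  images of the full space, so one irreducibility criterion covers them.\<close>

definition L24_chain :: "nat \<Rightarrow> (complex ^ 6) set" where
  "L24_chain i =
    (if i = 0 then zariski_closure (range (\<lambda>t :: complex ^ 6. line_param 0 0 0))
     else if i = 1 then zariski_closure (range (\<lambda>t :: complex ^ 6. line_param 0 0 (t $ 3)))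
     else if i = 2 then zariski_closure (range (\<lambda>t :: complex ^ 6. line_param (t $ 1) 0 (t $ 3)))
     else if i = 3 then zariski_closure (range (\<lambda>t :: complex ^ 6. line_param (t $ 1) (t $ 2) (t $ 3)))
     else if i = 4 then zariski_closure (range (\<lambda>t :: complex ^ 6. stewart_param (t $ 1) (t $ 2) (t $ 3) (t $ 4) (t $ 5)))
     else L24)"

lemma irreducible_L24_chain: "irreducible_closed (L24_chain i)"
  unfolding L24_chain_def line_param_def stewart_param_def Let_def
  by (simp only: split: if_split)
    (intro conjI impI irreducible_closed_L24 irreducible_closure_range vec6_poly_fun poly_fun_intros)

lemma L24_chain_psubset:
  assumes "i < 5"
  shows "L24_chain i \<subset> L24_chain (Suc i)"
proof -
  have sub: "S \<subseteq> zariski_closure T" if "S \<subseteq> T" for S T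
    using that zariski_closure_superset by blast
  consider "i = 0" | "i = 1" | "i = 2" | "i = 3" | "i = 4" using assms by linarith
  then show ?thesis
  proof cases
    case 1
    have "zariski_closure (range (\<lambda>t :: complex ^ 6. line_param 0 0 0))
        \<subset> zariski_closure (range (\<lambda>t :: complex ^ 6. line_param 0 0 (t $ 3)))"
    proof (rule zariski_closure_psubset[where g = "\<lambda>x. x $ 6"])
      show "range (\<lambda>t :: complex ^ 6. line_param 0 0 0)
          \<subseteq> zariski_closure (range (\<lambda>t :: complex ^ 6. line_param 0 0 (t $ 3)))"
        by (rule sub) (auto intro!: range_eqI[of _ _ "0 :: complex ^ 6"])
      show "line_param 0 0 (vec6 0 0 1 0 0 0 $ 3) \<in> range (\<lambda>t :: complex ^ 6. line_param 0 0 (t $ 3))"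
        by (rule rangeI)
    qed (use poly_fun.var[of 6] in \<open>auto simp: line_param_def\<close>)
    then show ?thesis using 1 by (simp add: L24_chain_def)
  next
    case 2
    have "zariski_closure (range (\<lambda>t :: complex ^ 6. line_param 0 0 (t $ 3)))
        \<subset> zariski_closure (range (\<lambda>t :: complex ^ 6. line_param (t $ 1) 0 (t $ 3)))"
    proof (rule zariski_closure_psubset[where g = "\<lambda>x. x $ 1"])
      show "range (\<lambda>t :: complex ^ 6. line_param 0 0 (t $ 3))
          \<subseteq> zariski_closure (range (\<lambda>t :: complex ^ 6. line_param (t $ 1) 0 (t $ 3)))"
      proof (intro sub image_subsetI)
        fix t :: "complex ^ 6"
        show "line_param 0 0 (t $ 3) \<in> range (\<lambda>t :: complex ^ 6. line_param (t $ 1) 0 (t $ 3))"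
          by (rule range_eqI[of _ _ "vec6 0 0 (t $ 3) 0 0 0"]) simp
      qed
      show "line_param (vec6 1 0 0 0 0 0 $ 1) 0 (vec6 1 0 0 0 0 0 $ 3)
          \<in> range (\<lambda>t :: complex ^ 6. line_param (t $ 1) 0 (t $ 3))"
        by (rule rangeI)
    qed (use poly_fun.var[of 1] in \<open>auto simp: line_param_def\<close>)
    then show ?thesis using 2 by (simp add: L24_chain_def)
  next
    case 3
    have "zariski_closure (range (\<lambda>t :: complex ^ 6. line_param (t $ 1) 0 (t $ 3)))
        \<subset> zariski_closure (range (\<lambda>t :: complex ^ 6. line_param (t $ 1) (t $ 2) (t $ 3)))"
    proof (rule zariski_closure_psubset[where g = "\<lambda>x. x $ 4"])
      show "range (\<lambda>t :: complex ^ 6. line_param (t $ 1) 0 (t $ 3))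
          \<subseteq> zariski_closure (range (\<lambda>t :: complex ^ 6. line_param (t $ 1) (t $ 2) (t $ 3)))"
      proof (intro sub image_subsetI)
        fix t :: "complex ^ 6"
        show "line_param (t $ 1) 0 (t $ 3) \<in> range (\<lambda>t :: complex ^ 6. line_param (t $ 1) (t $ 2) (t $ 3))"
          by (rule range_eqI[of _ _ "vec6 (t $ 1) 0 (t $ 3) 0 0 0"]) simp
      qed
      show "line_param (vec6 0 1 0 0 0 0 $ 1) (vec6 0 1 0 0 0 0 $ 2) (vec6 0 1 0 0 0 0 $ 3)
          \<in> range (\<lambda>t :: complex ^ 6. line_param (t $ 1) (t $ 2) (t $ 3))"
        by (rule rangeI)
    qed (use poly_fun.var[of 4] in \<open>auto simp: line_param_def\<close>)
    then show ?thesis using 3 by (simp add: L24_chain_def)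
  next
    case 4
    \<comment> \<open>Its image violates l34 = l24 + l23, a relation that holds throughout
      \<open>line_param\<close>.\<close>
    let ?t = "vec6 0 1 1 0 1 0"
    have "zariski_closure (range (\<lambda>t :: complex ^ 6. line_param (t $ 1) (t $ 2) (t $ 3)))
        \<subset> zariski_closure (range (\<lambda>t :: complex ^ 6. stewart_param (t $ 1) (t $ 2) (t $ 3) (t $ 4) (t $ 5)))"
    proof (rule zariski_closure_psubset[where g = "\<lambda>x. x $ 5 + x $ 4 - x $ 6"])
      show "range (\<lambda>t :: complex ^ 6. line_param (t $ 1) (t $ 2) (t $ 3))
          \<subseteq> zariski_closure (range (\<lambda>t :: complex ^ 6. stewart_param (t $ 1) (t $ 2) (t $ 3) (t $ 4) (t $ 5)))"
        using line_param_in_stewart_closure by blast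
      show "stewart_param (?t $ 1) (?t $ 2) (?t $ 3) (?t $ 4) (?t $ 5)
          \<in> range (\<lambda>t :: complex ^ 6. stewart_param (t $ 1) (t $ 2) (t $ 3) (t $ 4) (t $ 5))"
        by (rule rangeI)
      show "(\<lambda>x. x $ 5 + x $ 4 - x $ 6) \<in> poly_fun" by (intro poly_fun_intros)
    qed (auto simp: line_param_def stewart_param_def Let_def)
    then show ?thesis using 4 by (simp add: L24_chain_def)
  next
    case 5
    let ?Z = "zariski_closure (range (\<lambda>t :: complex ^ 6. stewart_param (t $ 1) (t $ 2) (t $ 3) (t $ 4) (t $ 5)))"
    have closed: "zariski_closed {x. x $ 2 - x $ 1 - x $ 4 = 0}" "zariski_closed L24"
      unfolding L24_eq by (intro zariski_closed_zeros poly_fun_intros cm_poly_fun)+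
    have "?Z \<subseteq> L24"
      by (rule zariski_closure_minimal[OF closed(2)]) (use stewart_param_in_L24 in blast)
    moreover have "?Z \<subseteq> {x. x $ 2 - x $ 1 - x $ 4 = 0}"
      by (rule zariski_closure_minimal[OF closed(1)]) (auto simp: stewart_param_def Let_def)
    moreover have "vec6 0 1 0 0 0 0 \<in> L24"
      by (simp add: L24_eq cmF_def cmA_def cmB_def cmC_def)
    ultimately have "?Z \<subset> L24" by auto
    then show ?thesis using 5 by (simp add: L24_chain_def)
  qed
qed

lemma local_dim_L24:
  assumes "p \<in> L24"
  shows "local_dim L24 p = 5"
  unfolding local_dim_def
proof (rule cSup_eq_maximum)
  show "5 \<in> {n. \<exists>c. (\<forall>i\<le>n. irreducible_closed (c i)) \<and> (\<forall>i<n. c i \<subset> c (Suc i)) \<and> c n \<subseteq> L24 \<and> p \<in> c n}"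
    using irreducible_L24_chain L24_chain_psubset assms
    by (intro CollectI exI[of _ L24_chain]) (auto simp: L24_chain_def)
  have "vec6 0 0 0 1 1 1 \<notin> L24"
    by (simp add: L24_eq cmF_def cmA_def cmB_def cmC_def)
  then show "n \<le> 5" if "n \<in> {n. \<exists>c. (\<forall>i\<le>n. irreducible_closed (c i)) \<and> (\<forall>i<n. c i \<subset> c (Suc i))
      \<and> c n \<subseteq> L24 \<and> p \<in> c n}" for n
    using that chain_length_le_5 by blast
qed

section \<open>Singular points are critical points\<close>

text \<open>The arguments of \<open>cm_det\<close> are the squared lengths \<open>12, 13, 14, 23, 24, 34\<close>; its other
  partial derivatives arise from \<open>cm_det_12\<close> by relabelling the vertices.\<close>
definition cm_det :: "complex \<Rightarrow> complex \<Rightarrow> complex \<Rightarrow> complex \<Rightarrow> complex \<Rightarrow> complex \<Rightarrow> complex" where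
  "cm_det a b c d e f = 8 * c * e * f - 2 * c * (e + f - d)\<^sup>2 - 2 * f * (c + e - a)\<^sup>2
     + 2 * (c + e - a) * (c + f - b) * (e + f - d) - 2 * e * (c + f - b)\<^sup>2"

definition cm_det_12 :: "complex \<Rightarrow> complex \<Rightarrow> complex \<Rightarrow> complex \<Rightarrow> complex \<Rightarrow> complex \<Rightarrow> complex" where
  "cm_det_12 a b c d e f = 4 * f * (c + e - a) - 2 * (c + f - b) * (e + f - d)"

lemma cm_det_derivative:
  assumes "(a has_field_derivative a') (at (t::complex))" "(b has_field_derivative b') (at t)"
    "(c has_field_derivative c') (at t)" "(d has_field_derivative d') (at t)"
    "(e has_field_derivative e') (at t)" "(f has_field_derivative f') (at t)"
  shows "((\<lambda>t. cm_det (a t) (b t) (c t) (d t) (e t) (f t)) has_field_derivative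
      cm_det_12 (a t) (b t) (c t) (d t) (e t) (f t) * a' + cm_det_12 (b t) (a t) (c t) (d t) (f t) (e t) * b'
    + cm_det_12 (c t) (b t) (a t) (f t) (e t) (d t) * c' + cm_det_12 (d t) (a t) (e t) (b t) (f t) (c t) * d'
    + cm_det_12 (e t) (d t) (a t) (f t) (c t) (b t) * e' + cm_det_12 (f t) (b t) (d t) (c t) (e t) (a t) * f')
    (at t)"
  unfolding cm_det_def
  by (rule derivative_eq_intros assms refl)+ (simp add: cm_det_12_def, algebra)

text \<open>The determinant and, up to a factor 2, its gradient in the lengths: the chain rule
  through the squares gives each partial derivative the length itself as a factor.\<close>

definition critical :: "complex \<Rightarrow> complex \<Rightarrow> complex \<Rightarrow> complex \<Rightarrow> complex \<Rightarrow> complex \<Rightarrow> bool" where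
  "critical a b c d e f \<longleftrightarrow>
    cm_det (a\<^sup>2) (b\<^sup>2) (c\<^sup>2) (d\<^sup>2) (e\<^sup>2) (f\<^sup>2) = 0 \<and>
    a * cm_det_12 (a\<^sup>2) (b\<^sup>2) (c\<^sup>2) (d\<^sup>2) (e\<^sup>2) (f\<^sup>2) = 0 \<and>
    b * cm_det_12 (b\<^sup>2) (a\<^sup>2) (c\<^sup>2) (d\<^sup>2) (f\<^sup>2) (e\<^sup>2) = 0 \<and>
    c * cm_det_12 (c\<^sup>2) (b\<^sup>2) (a\<^sup>2) (f\<^sup>2) (e\<^sup>2) (d\<^sup>2) = 0 \<and>
    d * cm_det_12 (d\<^sup>2) (a\<^sup>2) (e\<^sup>2) (b\<^sup>2) (f\<^sup>2) (c\<^sup>2) = 0 \<and>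
    e * cm_det_12 (e\<^sup>2) (d\<^sup>2) (a\<^sup>2) (f\<^sup>2) (c\<^sup>2) (b\<^sup>2) = 0 \<and>
    f * cm_det_12 (f\<^sup>2) (b\<^sup>2) (d\<^sup>2) (c\<^sup>2) (e\<^sup>2) (a\<^sup>2) = 0"

lemma cmF_eq_cm_det:
  "cmF x = cm_det ((x $ 1)\<^sup>2) ((x $ 2)\<^sup>2) ((x $ 3)\<^sup>2) ((x $ 4)\<^sup>2) ((x $ 5)\<^sup>2) ((x $ 6)\<^sup>2)"
  unfolding cmF_def cmA_def cmB_def cmC_def cm_det_def by algebra

lemma cmF_gradient:
  assumes p: "p \<in> L24"
  obtains G :: "complex ^ 6" where
    "\<And>v. ((\<lambda>t. cmF (p + t *s v)) has_field_derivative (\<Sum>i\<in>UNIV. G $ i * v $ i)) (at 0)"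
    "G = 0 \<longleftrightarrow> critical (p $ 1) (p $ 2) (p $ 3) (p $ 4) (p $ 5) (p $ 6)"
proof
  let ?G = "2 *s vec6
    (p $ 1 * cm_det_12 ((p $ 1)\<^sup>2) ((p $ 2)\<^sup>2) ((p $ 3)\<^sup>2) ((p $ 4)\<^sup>2) ((p $ 5)\<^sup>2) ((p $ 6)\<^sup>2))
    (p $ 2 * cm_det_12 ((p $ 2)\<^sup>2) ((p $ 1)\<^sup>2) ((p $ 3)\<^sup>2) ((p $ 4)\<^sup>2) ((p $ 6)\<^sup>2) ((p $ 5)\<^sup>2))
    (p $ 3 * cm_det_12 ((p $ 3)\<^sup>2) ((p $ 2)\<^sup>2) ((p $ 1)\<^sup>2) ((p $ 6)\<^sup>2) ((p $ 5)\<^sup>2) ((p $ 4)\<^sup>2))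
    (p $ 4 * cm_det_12 ((p $ 4)\<^sup>2) ((p $ 1)\<^sup>2) ((p $ 5)\<^sup>2) ((p $ 2)\<^sup>2) ((p $ 6)\<^sup>2) ((p $ 3)\<^sup>2))
    (p $ 5 * cm_det_12 ((p $ 5)\<^sup>2) ((p $ 4)\<^sup>2) ((p $ 1)\<^sup>2) ((p $ 6)\<^sup>2) ((p $ 3)\<^sup>2) ((p $ 2)\<^sup>2))
    (p $ 6 * cm_det_12 ((p $ 6)\<^sup>2) ((p $ 2)\<^sup>2) ((p $ 4)\<^sup>2) ((p $ 3)\<^sup>2) ((p $ 5)\<^sup>2) ((p $ 1)\<^sup>2))"
  have sq: "((\<lambda>t. ((p + t *s v) $ i)\<^sup>2) has_field_derivative 2 * p $ i * v $ i) (at 0)" for v i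
    by (auto intro!: derivative_eq_intros)
  show "((\<lambda>t. cmF (p + t *s v)) has_field_derivative (\<Sum>i\<in>UNIV. ?G $ i * v $ i)) (at 0)" for v
    unfolding cmF_eq_cm_det sum_6
    by (rule DERIV_cong[OF cm_det_derivative[OF sq sq sq sq sq sq]]) (simp add: algebra_simps)
  show "?G = 0 \<longleftrightarrow> critical (p $ 1) (p $ 2) (p $ 3) (p $ 4) (p $ 5) (p $ 6)"
    using p by (simp add: critical_def vec_eq_iff forall_6 L24_eq cmF_eq_cm_det)
qed

text \<open>Where F = 0, the derivative of F h is h times that of F, so the tangent space is the
  kernel of the gradient. A proper subspace has dimension at most 5, the local dimension.\<close>

theorem sing_L24_critical:
  "sing L24 = {p. critical (p $ 1) (p $ 2) (p $ 3) (p $ 4) (p $ 5) (p $ 6)}"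
proof -
  have "singular_point L24 p \<longleftrightarrow> critical (p $ 1) (p $ 2) (p $ 3) (p $ 4) (p $ 5) (p $ 6)"
    if p: "p \<in> L24" for p
  proof -
    obtain G where G: "\<And>v. ((\<lambda>t. cmF (p + t *s v)) has_field_derivative (\<Sum>i\<in>UNIV. G $ i * v $ i)) (at 0)"
      and crit: "G = 0 \<longleftrightarrow> critical (p $ 1) (p $ 2) (p $ 3) (p $ 4) (p $ 5) (p $ 6)"
      by (rule cmF_gradient[OF p]) (rule that)
    have T: "zariski_tangent L24 p = {v. (\<Sum>i\<in>UNIV. G $ i * v $ i) = 0}"
    proof (intro equalityI subsetI)
      fix v assume v: "v \<in> zariski_tangent L24 p"
      have "cmF \<in> vanishing_ideal L24" using cm_poly_fun by (simp add: vanishing_ideal_def L24_eq)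
      then have "deriv (\<lambda>t. cmF (p + t *s v)) 0 = 0" using v by (simp add: zariski_tangent_def)
      then show "v \<in> {v. (\<Sum>i\<in>UNIV. G $ i * v $ i) = 0}" using DERIV_imp_deriv[OF G] by simp
    next
      fix v assume v: "v \<in> {v. (\<Sum>i\<in>UNIV. G $ i * v $ i) = 0}"
      have "deriv (\<lambda>t. g (p + t *s v)) 0 = 0" if g: "g \<in> vanishing_ideal L24" for g
      proof -
        obtain h where h: "h \<in> poly_fun" "\<And>x. g x = cmF x * h x"
          using g unfolding vanishing_ideal_L24 by blast
        obtain H :: "complex ^ 6" where
          H: "((\<lambda>t. h (p + t *s v)) has_field_derivative (\<Sum>i\<in>UNIV. H $ i * v $ i)) (at 0)"
          using poly_fun_gradient[OF h(1)] by blast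
        have "((\<lambda>t. g (p + t *s v)) has_field_derivative 0) (at 0)"
          unfolding h(2) using DERIV_mult[OF G[of v] H] v p by (simp add: L24_eq)
        then show ?thesis by (rule DERIV_imp_deriv)
      qed
      then show "v \<in> zariski_tangent L24 p" by (simp add: zariski_tangent_def)
    qed
    have "vec.dim (zariski_tangent L24 p) > 5 \<longleftrightarrow> G = 0"
    proof
      assume "G = 0"
      then have "zariski_tangent L24 p = UNIV" by (simp add: T)
      then show "vec.dim (zariski_tangent L24 p) > 5" by (simp add: card_cart_basis)
    next
      assume dim: "vec.dim (zariski_tangent L24 p) > 5"
      have sub: "vec.subspace (zariski_tangent L24 p)"
        unfolding T by (rule vec.subspaceI)
          (auto simp: algebra_simps sum.distrib simp flip: sum_distrib_left)
      have "zariski_tangent L24 p = UNIV"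
      proof (rule ccontr)
        assume "zariski_tangent L24 p \<noteq> UNIV"
        then have "vec.span (zariski_tangent L24 p) \<subset> vec.span UNIV"
          using sub by (auto simp: vec.span_eq_iff[THEN iffD2])
        from vec.dim_psubset[OF this] show False using dim by (simp add: card_cart_basis)
      qed
      then have all: "(\<Sum>i\<in>UNIV. G $ i * v $ i) = 0" for v using T by auto
      have "G $ j = 0" for j
        using all[of "axis j 1"] by (simp add: axis_def if_distrib[of "(*) _"] cong: if_cong)
      then show "G = 0" by (simp add: vec_eq_iff)
    qed
    then show ?thesis using crit p by (simp add: singular_point_def local_dim_L24)
  qed
  moreover have "p \<in> L24" if "critical (p $ 1) (p $ 2) (p $ 3) (p $ 4) (p $ 5) (p $ 6)" for p
    using that by (simp add: critical_def L24_eq cmF_eq_cm_det)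
  ultimately show ?thesis unfolding sing_def singular_point_def by blast
qed

section \<open>The critical points\<close>

text \<open>The determinant is symmetric in the vertices although vertex 4 is the origin of the Gram
  matrix. The three adjacent transpositions generate all relabellings.\<close>

lemma critical_swap_12: "critical a b c d e f \<Longrightarrow> critical a d e b c f"
  unfolding critical_def cm_det_def cm_det_12_def by (elim conjE, intro conjI; algebra)

lemma critical_swap_23: "critical a b c d e f \<Longrightarrow> critical b a c d f e"
  unfolding critical_def cm_det_def cm_det_12_def by (elim conjE, intro conjI; algebra)

lemma critical_swap_34: "critical a b c d e f \<Longrightarrow> critical a c b e d f"
  unfolding critical_def cm_det_def cm_det_12_def by (elim conjE, intro conjI; algebra)

text \<open>The alternatives are type II for edge 12, type III for triangles 123 and 124, and, with
  l34 = 0, type II for edge 34 and type III for triangles 134 and 234. The split comes from the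
  derivative in l34, which is a multiple of f (D - B)(E - C).\<close>

lemma critical_zero_edge:
  assumes crit: "critical a b c d e f" and a0: "a = 0"
  shows "b\<^sup>2 = d\<^sup>2 \<and> c\<^sup>2 = e\<^sup>2 \<or> b = 0 \<and> d = 0 \<or> c = 0 \<and> e = 0
    \<or> f = 0 \<and> (b\<^sup>2 = c\<^sup>2 \<and> d\<^sup>2 = e\<^sup>2 \<or> b = 0 \<and> c = 0 \<or> d = 0 \<and> e = 0)"
proof -
  define B C D E F where sq: "B = b\<^sup>2" "C = c\<^sup>2" "D = d\<^sup>2" "E = e\<^sup>2" "F = f\<^sup>2"
  have zero_iff: "b = 0 \<longleftrightarrow> B = 0" "c = 0 \<longleftrightarrow> C = 0" "d = 0 \<longleftrightarrow> D = 0" "e = 0 \<longleftrightarrow> E = 0" "f = 0 \<longleftrightarrow> F = 0"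
    by (simp_all add: sq)
  have crit': "cm_det 0 B C D E F = 0" "b * cm_det_12 B 0 C D F E = 0" "c * cm_det_12 C B 0 F E D = 0"
    "d * cm_det_12 D 0 E B F C = 0" "e * cm_det_12 E D 0 F C B = 0" "f * cm_det_12 F B D C E 0 = 0"
    using crit unfolding critical_def a0 sq by simp_all
  have "- 2 * ((D - B) * (E - C) * F - (D - B - E + C) * (B * E - C * D)) = 0"
    using crit'(1) unfolding cm_det_def by algebra
  then have key: "(D - B) * (E - C) * F = (D - B - E + C) * (B * E - C * D)"
    unfolding mult_eq_0_iff by simp
  have "- 2 * (f * ((D - B) * (E - C))) = 0"
    using crit'(6) unfolding cm_det_12_def by algebra
  then have fz: "f = 0 \<or> D = B \<or> E = C" by auto
  consider "D = B" | "E = C" | "D \<noteq> B" "E \<noteq> C" "f = 0" using fz by blast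
  then show ?thesis
  proof cases
    case 1
    then have "(E - C) * (E - C) * D = (D - B) * (E - C) * F - (D - B - E + C) * (B * E - C * D)"
      by (simp add: algebra_simps)
    then have "(E - C) * (E - C) * D = 0" using key by simp
    then show ?thesis unfolding zero_iff using 1 by (auto simp: sq)
  next
    case 2
    then have "(D - B) * (D - B) * E = (D - B) * (E - C) * F - (D - B - E + C) * (B * E - C * D)"
      by (simp add: algebra_simps)
    then have "(D - B) * (D - B) * E = 0" using key by simp
    then show ?thesis unfolding zero_iff using 2 by (auto simp: sq)
  next
    case 3
    then have F: "F = 0" using zero_iff by simp
    \<comment> \<open>With l12 = l34 = 0 the determinant factors into P Q up to a constant.\<close>
    define P where "P = D - B - E + C"
    define Q where "Q = B * E - C * D"
    have PQ: "P * Q = 0" using key F by (simp add: P_def Q_def)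
    consider "B = C" | "D = E" | "B \<noteq> C" "D \<noteq> E" by blast
    then show ?thesis
    proof cases
      case 1
      then have "(D - E) * (D - E) * B = - (P * Q)" by (simp add: P_def Q_def algebra_simps)
      then have "(D - E) * (D - E) * B = 0" using PQ by simp
      then show ?thesis unfolding zero_iff using 1 F by (auto simp: sq)
    next
      case 2
      then have "(B - C) * (B - C) * D = - (P * Q)" by (simp add: P_def Q_def algebra_simps)
      then have "(B - C) * (B - C) * D = 0" using PQ by simp
      then show ?thesis unfolding zero_iff using 2 F by (auto simp: sq)
    next
      \<comment> \<open>This case is contradictory: the remaining four derivatives force one of the
        excluded equalities among B, C, D, E.\<close>
      case neq: 3
      have "2 * (b * (P * E - Q)) = 0" "2 * (c * (P * D - Q)) = 0"
        "2 * (d * (P * C - Q)) = 0" "2 * (e * (P * B - Q)) = 0"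
        using crit'(2-5) unfolding cm_det_12_def P_def Q_def F by algebra+
      then have d: "B = 0 \<or> P * E = Q" "C = 0 \<or> P * D = Q" "D = 0 \<or> P * C = Q" "E = 0 \<or> P * B = Q"
        using zero_iff by auto
      show ?thesis
      proof (cases "P = 0")
        case True
        then have "Q = 0" using d neq by auto
        then have "(B - C) * (B - D) = 0" using True unfolding P_def Q_def by algebra
        then show ?thesis using neq 3 by simp
      next
        case False
        then have "Q = 0" using PQ by simp
        then have "B = 0 \<or> E = 0" "C = 0 \<or> D = 0" using d False by auto
        then show ?thesis using neq 3 by auto
      qed
    qed
  qed
qed

text \<open>With vertex 4 at 0 and vertex 1 at c, the law of cosines gives the inner products m / 2
  and n / 2, so vertices 2 and 3 must lie at m / (2 c) and n / (2 c). The minors through the nonzero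
  entry 2 C confirm all distances.\<close>

lemma critical_nonzero_collinear:
  assumes crit: "critical a b c d e f" and nz: "a \<noteq> 0" "b \<noteq> 0" "c \<noteq> 0" "d \<noteq> 0" "e \<noteq> 0" "f \<noteq> 0"
  obtains p q r s where "a\<^sup>2 = (p - q)\<^sup>2" "b\<^sup>2 = (p - r)\<^sup>2" "c\<^sup>2 = (p - s)\<^sup>2"
    "d\<^sup>2 = (q - r)\<^sup>2" "e\<^sup>2 = (q - s)\<^sup>2" "f\<^sup>2 = (r - s)\<^sup>2"
proof
  define A B C D E F where sq: "A = a\<^sup>2" "B = b\<^sup>2" "C = c\<^sup>2" "D = d\<^sup>2" "E = e\<^sup>2" "F = f\<^sup>2"
  define m where "m = C + E - A"
  define n where "n = C + F - B"
  define k where "k = E + F - D"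
  have crit': "cm_det_12 A B C D E F = 0" "cm_det_12 B A C D F E = 0" "cm_det_12 C B A F E D = 0"
    "cm_det_12 D A E B F C = 0" "cm_det_12 E D A F C B = 0" "cm_det_12 F B D C E A = 0"
    using crit nz unfolding critical_def sq by simp_all
  have C: "C \<noteq> 0" using nz by (simp add: sq)
  have "2 * (m\<^sup>2 - 4 * C * E) = 0" "2 * (n\<^sup>2 - 4 * C * F) = 0" "2 * (2 * C * k - m * n) = 0"
    using crit' unfolding cm_det_12_def m_def n_def k_def by algebra+
  then have minors: "m\<^sup>2 = 4 * C * E" "n\<^sup>2 = 4 * C * F" "m * n = 2 * C * k" by (auto simp: mult.assoc)
  have c2: "c\<^sup>2 = C" by (simp add: sq)
  show "a\<^sup>2 = (c - m / (2 * c))\<^sup>2"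
  proof -
    have "(c - m / (2 * c))\<^sup>2 = C - m + m\<^sup>2 / (4 * C)"
      using nz(3) by (simp add: power2_diff power_divide power_mult_distrib c2)
    also have "\<dots> = A" unfolding minors using C by (simp add: m_def)
    finally show ?thesis by (simp add: sq)
  qed
  show "b\<^sup>2 = (c - n / (2 * c))\<^sup>2"
  proof -
    have "(c - n / (2 * c))\<^sup>2 = C - n + n\<^sup>2 / (4 * C)"
      using nz(3) by (simp add: power2_diff power_divide power_mult_distrib c2)
    also have "\<dots> = B" unfolding minors using C by (simp add: n_def)
    finally show ?thesis by (simp add: sq)
  qed
  show "d\<^sup>2 = (m / (2 * c) - n / (2 * c))\<^sup>2"
  proof -
    have "(m / (2 * c) - n / (2 * c))\<^sup>2 = (m\<^sup>2 + n\<^sup>2 - 2 * (m * n)) / (4 * C)"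
      by (simp add: power_divide power_mult_distrib c2 power2_diff flip: diff_divide_distrib)
    also have "\<dots> = D" unfolding minors using C by (simp add: k_def field_simps)
    finally show ?thesis by (simp add: sq)
  qed
  show "c\<^sup>2 = (c - 0)\<^sup>2" by simp
  show "e\<^sup>2 = (m / (2 * c) - 0)\<^sup>2"
    using C minors(1) by (simp add: power_divide power_mult_distrib c2 flip: sq)
  show "f\<^sup>2 = (n / (2 * c) - 0)\<^sup>2"
    using C minors(2) by (simp add: power_divide power_mult_distrib c2 flip: sq)
qed

text \<open>\<open>cm_det_12\<close> is twice a 2 by 2 minor of the Gram matrix, which has rank at
  most one for collinear points. The other derivatives are the same identity with relabelled
  points.\<close>

lemma critical_collinear:
  assumes "a\<^sup>2 = (p - q)\<^sup>2" "b\<^sup>2 = (p - r)\<^sup>2" "c\<^sup>2 = (p - s)\<^sup>2"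
    "d\<^sup>2 = (q - r)\<^sup>2" "e\<^sup>2 = (q - s)\<^sup>2" "f\<^sup>2 = (r - s)\<^sup>2"
  shows "critical a b c d e f"
proof -
  have "cm_det ((p - q)\<^sup>2) ((p - r)\<^sup>2) ((p - s)\<^sup>2) ((q - r)\<^sup>2) ((q - s)\<^sup>2) ((r - s)\<^sup>2) = 0"
    unfolding cm_det_def by algebra
  moreover have minor: "cm_det_12 ((p - q)\<^sup>2) ((p - r)\<^sup>2) ((p - s)\<^sup>2) ((q - r)\<^sup>2) ((q - s)\<^sup>2) ((r - s)\<^sup>2) = 0" for p q r s
    unfolding cm_det_12_def by algebra
  ultimately show ?thesis
    unfolding critical_def assms
    using minor[of p q r s] minor[of p r q s] minor[of p s r q] minor[of q r p s] minor[of q s r p] minor[of r s p q]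
    by (simp add: power2_commute)
qed

lemma critical_double_point: "b\<^sup>2 = d\<^sup>2 \<Longrightarrow> c\<^sup>2 = e\<^sup>2 \<Longrightarrow> critical 0 b c d e f"
  unfolding critical_def cm_det_def cm_det_12_def by (simp add: power2_eq_square algebra_simps)

lemma critical_null_triangle: "critical 0 0 c 0 e f"
  unfolding critical_def cm_det_def cm_det_12_def by (simp add: power2_eq_square algebra_simps)

section \<open>Relabelling the vertices\<close>

lemmas coord_simps_Suc = coord_simps[unfolded One_nat_def]

lemma coord_commute: "coord l i j = coord l j i"
  by (simp add: coord_def edge_idx_def min.commute max.commute)

text \<open>One labelling \<open>(a, b, c, e)\<close> of the vertices for each edge \<open>{a, b}\<close>.\<close>
definition edge_quads :: "(nat \<times> nat \<times> nat \<times> nat) set" where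
  "edge_quads = {(1,2,3,4), (1,3,2,4), (1,4,2,3), (2,3,1,4), (2,4,1,3), (3,4,1,2)}"

lemma critical_relabel:
  assumes "(a, b, c, e) \<in> edge_quads"
  shows "critical (l $ 1) (l $ 2) (l $ 3) (l $ 4) (l $ 5) (l $ 6) \<longleftrightarrow>
    critical (coord l a b) (coord l a c) (coord l a e) (coord l b c) (coord l b e) (coord l c e)"
proof -
  note swap = critical_swap_12 critical_swap_23 critical_swap_34
  have iff: "critical a b c d e f = critical a d e b c f" "critical a b c d e f = critical b a c d f e"
    "critical a b c d e f = critical a c b e d f" for a b c d e f
    using swap by blast+
  have perm: "critical u v w x y z = critical v u w x z y"
    "critical u v w x y z = critical w u v y z x"
    "critical u v w x y z = critical x u y v z w"
    "critical u v w x y z = critical y u x w z v"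
    "critical u v w x y z = critical z v x w y u" for u v w x y z
    using iff by metis+
  show ?thesis
    using assms unfolding edge_quads_def
    by (elim insertE emptyE Pair_inject) (simp_all only: coord_simps, (rule perm)+)
qed

lemma edge_quads_cases: "\<exists>(a, b, c, e)\<in>edge_quads. edge_idx a b = i"
  using exhaust_6[of i] unfolding edge_quads_def by (auto simp: edge_idx_def)

lemma edge_quads_set: "(a, b, c, e) \<in> edge_quads \<Longrightarrow> {a, b, c, e} = {1, 2, 3, 4} \<and> distinct [a, b, c, e]"
  unfolding edge_quads_def by auto

lemma L14_iff:
  "l \<in> L14 \<longleftrightarrow> (\<exists>p q r s. (l $ 1)\<^sup>2 = (p - q)\<^sup>2 \<and> (l $ 2)\<^sup>2 = (p - r)\<^sup>2 \<and> (l $ 3)\<^sup>2 = (p - s)\<^sup>2 \<and>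
    (l $ 4)\<^sup>2 = (q - r)\<^sup>2 \<and> (l $ 5)\<^sup>2 = (q - s)\<^sup>2 \<and> (l $ 6)\<^sup>2 = (r - s)\<^sup>2)" (is "_ \<longleftrightarrow> ?R")
proof
  assume "l \<in> L14"
  then obtain p where p: "\<And>i j. 1 \<le> i \<Longrightarrow> i < j \<Longrightarrow> j \<le> 4 \<Longrightarrow> (coord l i j)\<^sup>2 = (p i - p j)\<^sup>2"
    unfolding L14_def by blast
  from p[of 1 2] p[of 1 3] p[of 1 4] p[of 2 3] p[of 2 4] p[of 3 4]
  show ?R unfolding coord_simps by (intro exI[of _ "p 1"] exI[of _ "p 2"] exI[of _ "p 3"] exI[of _ "p 4"]) simp
next
  assume ?R
  then obtain p q r s where *: "(l $ 1)\<^sup>2 = (p - q)\<^sup>2" "(l $ 2)\<^sup>2 = (p - r)\<^sup>2" "(l $ 3)\<^sup>2 = (p - s)\<^sup>2"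
    "(l $ 4)\<^sup>2 = (q - r)\<^sup>2" "(l $ 5)\<^sup>2 = (q - s)\<^sup>2" "(l $ 6)\<^sup>2 = (r - s)\<^sup>2" by blast
  define P :: "nat \<Rightarrow> complex" where "P = (\<lambda>i. if i = 1 then p else if i = 2 then q else if i = 3 then r else s)"
  have "(coord l i j)\<^sup>2 = (P i - P j)\<^sup>2" if "1 \<le> i" "i < j" "j \<le> 4" for i j
  proof -
    have "i = 1 \<or> i = 2 \<or> i = 3" "j = 2 \<or> j = 3 \<or> j = 4" using that by auto
    then show ?thesis using * that by (elim disjE) (simp_all add: coord_simps_Suc P_def)
  qed
  then show "l \<in> L14" unfolding L14_def by blast
qed

section \<open>The three families of subspaces\<close>

definition signs :: "complex set" where "signs = {1, -1}"

lemma signs_square: "s \<in> signs \<Longrightarrow> s * (s * x) = x"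
  by (auto simp: signs_def)

lemma square_eq_iff_sign: "x\<^sup>2 = y\<^sup>2 \<longleftrightarrow> (\<exists>s\<in>signs. x = s * y)" for x y :: complex
  by (auto simp: signs_def power2_eq_iff)

lemma square_eq_iff_sign': "x\<^sup>2 = y\<^sup>2 \<longleftrightarrow> (\<exists>s\<in>signs. s * x = y)" for x y :: complex
  by (auto simp: signs_def power2_eq_iff)

definition typeI_space :: "complex \<Rightarrow> complex \<Rightarrow> complex \<Rightarrow> complex \<Rightarrow> complex \<Rightarrow> (complex ^ 6) set" where
  "typeI_space s13 s23 s14 s24 s34 = {l. l $ 1 - s13 * l $ 2 + s23 * l $ 4 = 0
     \<and> l $ 1 - s14 * l $ 3 + s24 * l $ 5 = 0 \<and> s13 * l $ 2 - s14 * l $ 3 + s34 * l $ 6 = 0}"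

lemma typeI_eq:
  "typeI = (\<lambda>(s13, s23, s14, s24, s34). typeI_space s13 s23 s14 s24 s34) ` (signs \<times> signs \<times> signs \<times> signs \<times> signs)"
proof (intro equalityI subsetI)
  fix V assume "V \<in> typeI"
  then obtain s13 s23 s14 s24 s34 where "{s13, s23, s14, s24, s34} \<subseteq> signs" "V = typeI_space s13 s23 s14 s24 s34"
    unfolding typeI_def typeI_space_def coord_simps signs_def by blast
  then show "V \<in> (\<lambda>(s13, s23, s14, s24, s34). typeI_space s13 s23 s14 s24 s34) ` (signs \<times> signs \<times> signs \<times> signs \<times> signs)"
    by (intro image_eqI[of _ _ "(s13, s23, s14, s24, s34)"]) auto
next
  fix V assume "V \<in> (\<lambda>(s13, s23, s14, s24, s34). typeI_space s13 s23 s14 s24 s34) ` (signs \<times> signs \<times> signs \<times> signs \<times> signs)"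
  then obtain s13 s23 s14 s24 s34 where "{s13, s23, s14, s24, s34} \<subseteq> signs" "V = typeI_space s13 s23 s14 s24 s34"
    by auto
  then show "V \<in> typeI"
    unfolding typeI_def typeI_space_def coord_simps signs_def by blast
qed

text \<open>Points 0, - l12, - s13 l13, - s14 l14 realize a member of a type I space: its equations
  say that the other three lengths are differences up to sign.\<close>

lemma Union_typeI: "\<Union>typeI = L14"
proof (intro equalityI subsetI)
  fix l assume "l \<in> \<Union>typeI"
  then obtain s13 s23 s14 s24 s34 where s: "s13 \<in> signs" "s23 \<in> signs" "s14 \<in> signs" "s24 \<in> signs" "s34 \<in> signs"
    and l: "l \<in> typeI_space s13 s23 s14 s24 s34" unfolding typeI_eq by auto
  have "(l $ 4)\<^sup>2 = (s23 * l $ 4)\<^sup>2" "(l $ 5)\<^sup>2 = (s24 * l $ 5)\<^sup>2" "(l $ 6)\<^sup>2 = (s34 * l $ 6)\<^sup>2"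
    "(l $ 2)\<^sup>2 = (s13 * l $ 2)\<^sup>2" "(l $ 3)\<^sup>2 = (s14 * l $ 3)\<^sup>2"
    using s by (auto simp: signs_def)
  moreover have "s23 * l $ 4 = - l $ 1 - - s13 * l $ 2" "s24 * l $ 5 = - l $ 1 - - s14 * l $ 3"
    "s34 * l $ 6 = - s13 * l $ 2 - - s14 * l $ 3"
    using l unfolding typeI_space_def by (auto simp: algebra_simps eq_neg_iff_add_eq_0)
  ultimately show "l \<in> L14"
    unfolding L14_iff
    by (intro exI[of _ 0] exI[of _ "- l $ 1"] exI[of _ "- s13 * l $ 2"] exI[of _ "- s14 * l $ 3"]) simp
next
  fix l assume "l \<in> L14"
  then obtain p q r s where sq: "(l $ 1)\<^sup>2 = (p - q)\<^sup>2" "(l $ 2)\<^sup>2 = (p - r)\<^sup>2" "(l $ 3)\<^sup>2 = (p - s)\<^sup>2"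
    "(l $ 4)\<^sup>2 = (q - r)\<^sup>2" "(l $ 5)\<^sup>2 = (q - s)\<^sup>2" "(l $ 6)\<^sup>2 = (r - s)\<^sup>2" unfolding L14_iff by blast
  \<comment> \<open>The equations give l12 the fixed sign +1. Reflecting the line by \<sigma>
    achieves this, which is why five signs suffice for six edges.\<close>
  obtain \<sigma> where \<sigma>: "\<sigma> \<in> signs" "l $ 1 = \<sigma> * (p - q)" using sq(1) square_eq_iff_sign by blast
  have sign: "\<exists>s\<in>signs. s * y = \<sigma> * x" if "y\<^sup>2 = x\<^sup>2" for x y
    using that \<sigma>(1) unfolding square_eq_iff_sign'[symmetric] by (auto simp: signs_def)
  obtain s13 where s13: "s13 \<in> signs" "s13 * l $ 2 = \<sigma> * (p - r)" using sign[OF sq(2)] by blast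
  obtain s14 where s14: "s14 \<in> signs" "s14 * l $ 3 = \<sigma> * (p - s)" using sign[OF sq(3)] by blast
  obtain s23 where s23: "s23 \<in> signs" "s23 * l $ 4 = \<sigma> * (q - r)" using sign[OF sq(4)] by blast
  obtain s24 where s24: "s24 \<in> signs" "s24 * l $ 5 = \<sigma> * (q - s)" using sign[OF sq(5)] by blast
  obtain s34 where s34: "s34 \<in> signs" "s34 * l $ 6 = \<sigma> * (r - s)" using sign[OF sq(6)] by blast
  have "l \<in> typeI_space s13 s23 s14 s24 s34"
    unfolding typeI_space_def mem_Collect_eq s13(2) s14(2) s23(2) s24(2) s34(2) \<sigma>(2) by (simp add: algebra_simps)
  with s13 s14 s23 s24 s34 show "l \<in> \<Union>typeI" unfolding typeI_eq by force
qed

definition typeII_space :: "nat \<Rightarrow> nat \<Rightarrow> nat \<Rightarrow> nat \<Rightarrow> complex \<Rightarrow> complex \<Rightarrow> (complex ^ 6) set" where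
  "typeII_space a b c e s t =
    {l. coord l a b = 0 \<and> coord l a c = s * coord l b c \<and> coord l a e = t * coord l b e}"

definition typeIII_space :: "nat \<Rightarrow> nat \<Rightarrow> nat \<Rightarrow> (complex ^ 6) set" where
  "typeIII_space a b c = {l. coord l a b = 0 \<and> coord l a c = 0 \<and> coord l b c = 0}"

lemma typeII_iff:
  "V \<in> typeII \<longleftrightarrow> (\<exists>a b c e s t. {a, b, c, e} = {1, 2, 3, 4} \<and> s \<in> signs \<and> t \<in> signs
    \<and> V = typeII_space a b c e s t)"
  by (simp add: typeII_def typeII_space_def signs_def)

lemma quad_permutations:
  fixes a b c e :: nat
  assumes "{a, b, c, e} = {1, 2, 3, 4}"
  shows "(a, b, c, e) \<in> edge_quads \<or> (b, a, c, e) \<in> edge_quads \<or> (a, b, e, c) \<in> edge_quads \<or> (b, a, e, c) \<in> edge_quads"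
proof -
  have mem: "a \<in> {1, 2, 3, 4}" "b \<in> {1, 2, 3, 4}" "c \<in> {1, 2, 3, 4}" "e \<in> {1, 2, 3, 4}"
    using assms by blast+
  have "card {a, b, c, e} = 4" unfolding assms by simp
  then have dist: "a \<noteq> b" "a \<noteq> c" "a \<noteq> e" "b \<noteq> c" "b \<noteq> e" "c \<noteq> e"
    by (auto simp: card_insert_if split: if_splits)
  have sorted: "(a, b, c, e) \<in> edge_quads"
    if "a < b" "c < e" "a \<in> {1, 2, 3, 4}" "b \<in> {1, 2, 3, 4}" "c \<in> {1, 2, 3, 4}" "e \<in> {1, 2, 3, 4}"
      "a \<noteq> c" "a \<noteq> e" "b \<noteq> c" "b \<noteq> e" for a b c e :: nat
  proof -
    have "(a, b) \<in> {(1,2), (1,3), (1,4), (2,3), (2,4), (3,4)}" using that(1,3,4) by auto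
    moreover have "(c, e) \<in> {(1,2), (1,3), (1,4), (2,3), (2,4), (3,4)}" using that(2,5,6) by auto
    ultimately show ?thesis using that(7-) unfolding edge_quads_def by auto
  qed
  show ?thesis
    using sorted[of a b c e] sorted[of b a c e] sorted[of a b e c] sorted[of b a e c] mem dist
    by (metis linorder_neq_iff)
qed

lemma typeII_space_swap:
  assumes "s \<in> signs" "t \<in> signs"
  shows "typeII_space b a c e s t = typeII_space a b c e s t" "typeII_space a b e c t s = typeII_space a b c e s t"
proof -
  have swap: "x = s * y \<longleftrightarrow> y = s * x" if "s \<in> signs" for s x y
    using that by (auto simp: signs_def)
  show "typeII_space b a c e s t = typeII_space a b c e s t"
    unfolding typeII_space_def coord_commute[of _ b a] swap[OF assms(1), of "coord _ b c"]
      swap[OF assms(2), of "coord _ b e"] ..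
  show "typeII_space a b e c t s = typeII_space a b c e s t"
    unfolding typeII_space_def by auto
qed

text \<open>The definition runs over all 24 labellings. Exchanging \<open>a\<close> with
  \<open>b\<close>, or \<open>c\<close> with \<open>e\<close> along with the two signs, gives the
  same space, so one labelling per edge remains.\<close>

lemma typeII_eq:
  "typeII = (\<lambda>((a, b, c, e), s, t). typeII_space a b c e s t) ` (edge_quads \<times> signs \<times> signs)"
proof (intro equalityI subsetI)
  fix V assume "V \<in> typeII"
  then obtain a b c e s t where V: "{a, b, c, e} = {1, 2, 3, 4}" "s \<in> signs" "t \<in> signs" "V = typeII_space a b c e s t"
    unfolding typeII_iff by blast
  have "\<exists>q\<in>edge_quads \<times> signs \<times> signs. V = (\<lambda>((a, b, c, e), s, t). typeII_space a b c e s t) q"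
    using quad_permutations[OF V(1)]
  proof (elim disjE)
    assume "(a, b, c, e) \<in> edge_quads"
    then show ?thesis using V by (intro bexI[of _ "((a, b, c, e), s, t)"]) auto
  next
    assume "(b, a, c, e) \<in> edge_quads"
    then show ?thesis using V typeII_space_swap by (intro bexI[of _ "((b, a, c, e), s, t)"]) auto
  next
    assume "(a, b, e, c) \<in> edge_quads"
    then show ?thesis using V typeII_space_swap by (intro bexI[of _ "((a, b, e, c), t, s)"]) auto
  next
    assume "(b, a, e, c) \<in> edge_quads"
    then show ?thesis using V typeII_space_swap by (intro bexI[of _ "((b, a, e, c), t, s)"]) auto
  qed
  then show "V \<in> (\<lambda>((a, b, c, e), s, t). typeII_space a b c e s t) ` (edge_quads \<times> signs \<times> signs)"
    by blast
next
  fix V assume "V \<in> (\<lambda>((a, b, c, e), s, t). typeII_space a b c e s t) ` (edge_quads \<times> signs \<times> signs)"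
  then obtain a b c e s t where V: "(a, b, c, e) \<in> edge_quads" "s \<in> signs" "t \<in> signs" "V = typeII_space a b c e s t"
    by auto
  show "V \<in> typeII"
    unfolding typeII_iff using edge_quads_set[OF V(1)] V(2-4) by metis
qed

lemma typeIII_iff:
  "V \<in> typeIII \<longleftrightarrow> (\<exists>a b c. {a, b, c} \<subseteq> {1, 2, 3, 4} \<and> distinct [a, b, c] \<and> V = typeIII_space a b c)"
proof -
  have "card {a, b, c} = 3 \<longleftrightarrow> distinct [a, b, c]" for a b c :: nat
    by (simp add: card_insert_if)
  then show ?thesis unfolding typeIII_def typeIII_space_def by simp
qed

lemma typeIII_eq: "typeIII = {typeIII_space 1 2 3, typeIII_space 1 2 4, typeIII_space 1 3 4, typeIII_space 2 3 4}"
proof (intro equalityI subsetI)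
  fix V assume "V \<in> typeIII"
  then obtain a b c where V: "V = typeIII_space a b c"
    and abc: "a \<in> {1, 2, 3, 4}" "b \<in> {1, 2, 3, 4}" "c \<in> {1, 2, 3, 4}" "distinct [a, b, c]"
    unfolding typeIII_iff by auto
  have swap: "typeIII_space b a c = typeIII_space a b c" "typeIII_space a c b = typeIII_space a b c" for a b c
    unfolding typeIII_space_def coord_commute[of _ b a] coord_commute[of _ c b] by auto
  show "V \<in> {typeIII_space 1 2 3, typeIII_space 1 2 4, typeIII_space 1 3 4, typeIII_space 2 3 4}"
    using abc unfolding V by (simp, elim disjE; simp; metis swap)
next
  have "typeIII_space a b c \<in> typeIII" if "{a, b, c} \<subseteq> {1, 2, 3, 4}" "distinct [a, b, c]" for a b c
    using that unfolding typeIII_iff by blast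
  then show "V \<in> typeIII"
    if "V \<in> {typeIII_space 1 2 3, typeIII_space 1 2 4, typeIII_space 1 3 4, typeIII_space 2 3 4}" for V
    using that by auto
qed

lemma Union_types_eq_critical:
  "\<Union>(typeI \<union> typeII \<union> typeIII) = {l. critical (l $ 1) (l $ 2) (l $ 3) (l $ 4) (l $ 5) (l $ 6)}"
proof (intro equalityI subsetI CollectI)
  fix l assume "l \<in> \<Union>(typeI \<union> typeII \<union> typeIII)"
  then consider "l \<in> \<Union>typeI" | "l \<in> \<Union>typeII" | "l \<in> \<Union>typeIII" by blast
  then show "critical (l $ 1) (l $ 2) (l $ 3) (l $ 4) (l $ 5) (l $ 6)"
  proof cases
    case 1
    then show ?thesis unfolding Union_typeI L14_iff using critical_collinear by blast
  next
    case 2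
    then obtain a b c e s t where q: "(a, b, c, e) \<in> edge_quads" and st: "s \<in> signs" "t \<in> signs"
      and l: "l \<in> typeII_space a b c e s t"
      unfolding typeII_eq by auto
    have "(coord l a c)\<^sup>2 = (coord l b c)\<^sup>2" "(coord l a e)\<^sup>2 = (coord l b e)\<^sup>2" "coord l a b = 0"
      using l st unfolding typeII_space_def square_eq_iff_sign by auto
    then show ?thesis unfolding critical_relabel[OF q] using critical_double_point by simp
  next
    case 3
    have "critical 0 b 0 d 0 f" "critical a 0 0 d e 0" "critical a b c 0 0 0" for a b c d e f
      unfolding critical_def cm_det_def cm_det_12_def by simp_all
    with 3 show ?thesis
      unfolding typeIII_eq typeIII_space_def coord_simps using critical_null_triangle by auto
  qed
next
  fix l :: "complex ^ 6" assume "l \<in> {l. critical (l $ 1) (l $ 2) (l $ 3) (l $ 4) (l $ 5) (l $ 6)}"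
  then have crit: "critical (l $ 1) (l $ 2) (l $ 3) (l $ 4) (l $ 5) (l $ 6)" by simp
  show "l \<in> \<Union>(typeI \<union> typeII \<union> typeIII)"
  proof (cases "\<exists>i. l $ i = 0")
    case False
    then have "l \<in> L14" unfolding L14_iff using critical_nonzero_collinear[OF crit] by metis
    then show ?thesis unfolding Union_typeI[symmetric] by blast
  next
    case True
    then obtain i where "l $ i = 0" by blast
    moreover obtain a b c e where q: "(a, b, c, e) \<in> edge_quads" "edge_idx a b = i"
      using edge_quads_cases[of i] by blast
    ultimately have ab: "coord l a b = 0" by (simp add: coord_def)
    note set = edge_quads_set[OF q(1)]
    have II: "l \<in> \<Union>typeII" if abce: "{a, b, c, e} = {1, 2, 3, 4}" "coord l a b = 0"
      and sq: "(coord l a c)\<^sup>2 = (coord l b c)\<^sup>2" "(coord l a e)\<^sup>2 = (coord l b e)\<^sup>2" for a b c e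
    proof -
      obtain s t where "s \<in> signs" "t \<in> signs" "coord l a c = s * coord l b c" "coord l a e = t * coord l b e"
        using sq unfolding square_eq_iff_sign by blast
      then have "l \<in> typeII_space a b c e s t" "typeII_space a b c e s t \<in> typeII"
        using abce(2) by (simp add: typeII_space_def, metis typeII_iff abce(1))
      then show ?thesis by blast
    qed
    have III: "l \<in> \<Union>typeIII" if "{a, b, c} \<subseteq> {1, 2, 3, 4}" "distinct [a, b, c]"
      "coord l a b = 0" "coord l a c = 0" "coord l b c = 0" for a b c
    proof -
      have "l \<in> typeIII_space a b c" using that(3-5) by (simp add: typeIII_space_def)
      moreover have "typeIII_space a b c \<in> typeIII" unfolding typeIII_iff using that(1,2) by blast
      ultimately show ?thesis by blast
    qed
    have sub: "{a, b, c} \<subseteq> {1, 2, 3, 4}" "{a, b, e} \<subseteq> {1, 2, 3, 4}" "{a, c, e} \<subseteq> {1, 2, 3, 4}" "{b, c, e} \<subseteq> {1, 2, 3, 4}"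
      "{c, e, a, b} = {1, 2, 3, 4}"
      using set by blast+
    have "l \<in> \<Union>typeII \<or> l \<in> \<Union>typeIII"
      using critical_zero_edge[OF crit[unfolded critical_relabel[OF q(1)]] ab]
    proof (elim disjE conjE)
      assume "(coord l a c)\<^sup>2 = (coord l b c)\<^sup>2" "(coord l a e)\<^sup>2 = (coord l b e)\<^sup>2"
      then show ?thesis using II[of a b c e] set ab by simp
    next
      assume "coord l a c = 0" "coord l b c = 0"
      then show ?thesis using III[OF sub(1)] set ab by simp
    next
      assume "coord l a e = 0" "coord l b e = 0"
      then show ?thesis using III[OF sub(2)] set ab by simp
    next
      assume "coord l c e = 0" "(coord l a c)\<^sup>2 = (coord l a e)\<^sup>2" "(coord l b c)\<^sup>2 = (coord l b e)\<^sup>2"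
      then have "l \<in> \<Union>typeII"
        by (intro II[OF sub(5)]) (simp_all only: coord_commute[of l c] coord_commute[of l e a] coord_commute[of l e b])
      then show ?thesis ..
    next
      assume "coord l c e = 0" "coord l a c = 0" "coord l a e = 0"
      then show ?thesis using III[OF sub(3)] set by simp
    next
      assume "coord l c e = 0" "coord l b c = 0" "coord l b e = 0"
      then show ?thesis using III[OF sub(4)] set by simp
    qed
    then show ?thesis by blast
  qed
qed

section \<open>Dimensions and counting\<close>

text \<open>Projection to three coordinates is an isomorphism: \<open>ex\<close> is its surjectivity
  and \<open>zero\<close> its injectivity.\<close>

lemma vec_dim_eq_3I:
  fixes V :: "(complex ^ 6) set"
  assumes V: "vec.subspace V"
    and ex: "\<And>x y z. \<exists>l\<in>V. l $ i = x \<and> l $ j = y \<and> l $ k = z"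
    and zero: "\<And>l. l \<in> V \<Longrightarrow> l $ i = 0 \<Longrightarrow> l $ j = 0 \<Longrightarrow> l $ k = 0 \<Longrightarrow> l = 0"
  shows "vec.dim V = 3"
proof -
  obtain u where u: "u \<in> V" "u $ i = 1" "u $ j = 0" "u $ k = 0" using ex by blast
  obtain v where v: "v \<in> V" "v $ i = 0" "v $ j = 1" "v $ k = 0" using ex by blast
  obtain w where w: "w \<in> V" "w $ i = 0" "w $ j = 0" "w $ k = 1" using ex by blast
  have distinct: "u \<noteq> v" "u \<noteq> w" "v \<noteq> w" using u v w by auto
  have "l \<in> vec.span {u, v, w}" if "l \<in> V" for l
  proof -
    have "l - (l $ i *s u + l $ j *s v + l $ k *s w) = 0"
      using u v w V that
      by (intro zero vec.subspace_diff vec.subspace_add vec.subspace_scale) auto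
    then have "l = l $ i *s u + l $ j *s v + l $ k *s w" by simp
    also have "\<dots> \<in> vec.span {u, v, w}"
      by (intro vec.span_add vec.span_scale vec.span_base) auto
    finally show ?thesis .
  qed
  moreover have "vec.independent {u, v, w}"
  proof (rule vec.independent_if_scalars_zero)
    fix f x assume f: "(\<Sum>x\<in>{u, v, w}. f x *s x) = 0" and x: "x \<in> {u, v, w}"
    have "f u *s u + f v *s v + f w *s w = 0" using f distinct by (simp add: add.assoc)
    then have "(f u *s u + f v *s v + f w *s w) $ m = 0" for m by simp
    from this[of i] this[of j] this[of k] have "f u = 0" "f v = 0" "f w = 0" using u v w by simp_all
    then show "f x = 0" using x by blast
  qed simp
  ultimately show ?thesis
    using u(1) v(1) w(1) distinct by (intro vec.dim_unique[of "{u, v, w}"]) auto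
qed

lemma signs_nonzero: "s \<in> signs \<Longrightarrow> s \<noteq> 0"
  by (auto simp: signs_def)

lemma signs_mult: "s \<in> signs \<Longrightarrow> t \<in> signs \<Longrightarrow> s * t \<in> signs"
  by (auto simp: signs_def)

lemma edge_idx_simps:
  "edge_idx 1 2 = 1" "edge_idx 1 3 = 2" "edge_idx 1 4 = 3" "edge_idx 2 3 = 4" "edge_idx 2 4 = 5" "edge_idx 3 4 = 6"
  "edge_idx 2 1 = 1" "edge_idx 3 1 = 2" "edge_idx 4 1 = 3" "edge_idx 3 2 = 4" "edge_idx 4 2 = 5" "edge_idx 4 3 = 6"
  by (simp_all add: edge_idx_def)

lemma coord_linear: "coord 0 i j = 0" "coord (l + m) i j = coord l i j + coord m i j" "coord (c *s l) i j = c * coord l i j"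
  by (simp_all add: coord_def)

lemma typeI_space_dim:
  assumes s: "s13 \<in> signs" "s23 \<in> signs" "s14 \<in> signs" "s24 \<in> signs" "s34 \<in> signs"
  shows "vec.subspace (typeI_space s13 s23 s14 s24 s34)" "vec.dim (typeI_space s13 s23 s14 s24 s34) = 3"
proof -
  show sub: "vec.subspace (typeI_space s13 s23 s14 s24 s34)"
  proof (rule vec.subspaceI)
    show "c *s l \<in> typeI_space s13 s23 s14 s24 s34" if "l \<in> typeI_space s13 s23 s14 s24 s34" for c l
    proof -
      have "c * (l $ 1 - s13 * l $ 2 + s23 * l $ 4) = 0" "c * (l $ 1 - s14 * l $ 3 + s24 * l $ 5) = 0"
        "c * (s13 * l $ 2 - s14 * l $ 3 + s34 * l $ 6) = 0"
        using that unfolding typeI_space_def by auto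
      then show ?thesis unfolding typeI_space_def by (simp add: algebra_simps)
    qed
    show "l + m \<in> typeI_space s13 s23 s14 s24 s34"
      if "l \<in> typeI_space s13 s23 s14 s24 s34" "m \<in> typeI_space s13 s23 s14 s24 s34" for l m
    proof -
      have "(l $ 1 - s13 * l $ 2 + s23 * l $ 4) + (m $ 1 - s13 * m $ 2 + s23 * m $ 4) = 0"
        "(l $ 1 - s14 * l $ 3 + s24 * l $ 5) + (m $ 1 - s14 * m $ 3 + s24 * m $ 5) = 0"
        "(s13 * l $ 2 - s14 * l $ 3 + s34 * l $ 6) + (s13 * m $ 2 - s14 * m $ 3 + s34 * m $ 6) = 0"
        using that unfolding typeI_space_def by auto
      then show ?thesis unfolding typeI_space_def by (simp add: algebra_simps)
    qed
  qed (simp add: typeI_space_def)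
  show "vec.dim (typeI_space s13 s23 s14 s24 s34) = 3"
  proof (rule vec_dim_eq_3I[OF sub, of 1 2 3])
    fix x y z
    have "vec6 x y z (s23 * (s13 * y - x)) (s24 * (s14 * z - x)) (s34 * (s14 * z - s13 * y))
        \<in> typeI_space s13 s23 s14 s24 s34"
      using s by (simp add: typeI_space_def signs_square)
    then show "\<exists>l\<in>typeI_space s13 s23 s14 s24 s34. l $ 1 = x \<and> l $ 2 = y \<and> l $ 3 = z"
      by (rule bexI[rotated]) simp
  next
    fix l assume "l \<in> typeI_space s13 s23 s14 s24 s34" "l $ 1 = 0" "l $ 2 = 0" "l $ 3 = 0"
    then show "l = 0" using s[THEN signs_nonzero] by (simp add: typeI_space_def vec_eq_iff forall_6)
  qed
qed

definition quad_point :: "nat \<Rightarrow> nat \<Rightarrow> nat \<Rightarrow> nat \<Rightarrow> complex \<Rightarrow> complex \<Rightarrow> complex \<Rightarrow> complex \<Rightarrow> complex \<Rightarrow> complex ^ 6" where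
  "quad_point a b c e u v w x y = (\<chi> i. if i = edge_idx a b then 0 else if i = edge_idx a c then u
     else if i = edge_idx b c then v else if i = edge_idx a e then w else if i = edge_idx b e then x else y)"

lemma edge_quads_distinct_idx:
  assumes "(a, b, c, e) \<in> edge_quads"
  shows "distinct [edge_idx a b, edge_idx a c, edge_idx b c, edge_idx a e, edge_idx b e, edge_idx c e]"
  using assms unfolding edge_quads_def
  by (elim insertE emptyE Pair_inject) (simp_all only: edge_idx_simps, simp_all)

lemma quad_point_coords:
  assumes "(a, b, c, e) \<in> edge_quads"
  shows "coord (quad_point a b c e u v w x y) a b = 0" "coord (quad_point a b c e u v w x y) a c = u"
    "coord (quad_point a b c e u v w x y) b c = v" "coord (quad_point a b c e u v w x y) a e = w"
    "coord (quad_point a b c e u v w x y) b e = x" "coord (quad_point a b c e u v w x y) c e = y"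
  using edge_quads_distinct_idx[OF assms] by (auto simp: quad_point_def coord_def)

lemma distinct_6_UNIV:
  fixes i j k i' j' k' :: 6
  assumes "distinct [i, j, k, i', j', k']"
  shows "m \<in> {i, j, k, i', j', k'}"
proof -
  have "set [i, j, k, i', j', k'] = UNIV"
    by (rule card_subset_eq) (use distinct_card[OF assms] in auto)
  then show ?thesis by auto
qed

lemma eq_zero_if_quad_coords_zero:
  assumes "(a, b, c, e) \<in> edge_quads" "coord l a b = 0" "coord l a c = 0" "coord l b c = 0"
    "coord l a e = 0" "coord l b e = 0" "coord l c e = 0"
  shows "l = 0"
proof -
  have "l $ m = 0" for m
    using distinct_6_UNIV[OF edge_quads_distinct_idx[OF assms(1)], of m] assms(2-) by (auto simp: coord_def)
  then show ?thesis by (simp add: vec_eq_iff)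
qed

lemma typeII_space_dim:
  assumes q: "(a, b, c, e) \<in> edge_quads"
  shows "vec.subspace (typeII_space a b c e s t)" "vec.dim (typeII_space a b c e s t) = 3"
proof -
  show sub: "vec.subspace (typeII_space a b c e s t)"
    by (rule vec.subspaceI) (auto simp: typeII_space_def coord_linear algebra_simps)
  show "vec.dim (typeII_space a b c e s t) = 3"
  proof (rule vec_dim_eq_3I[OF sub, of "edge_idx b c" "edge_idx b e" "edge_idx c e"])
    fix x y z
    show "\<exists>l\<in>typeII_space a b c e s t. l $ edge_idx b c = x \<and> l $ edge_idx b e = y \<and> l $ edge_idx c e = z"
      unfolding coord_def[symmetric] typeII_space_def
      by (intro bexI[of _ "quad_point a b c e (s * x) x (t * y) y z"]) (auto simp: quad_point_coords[OF q])
  next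
    fix l assume "l \<in> typeII_space a b c e s t" "l $ edge_idx b c = 0" "l $ edge_idx b e = 0" "l $ edge_idx c e = 0"
    then show "l = 0"
      unfolding coord_def[symmetric] typeII_space_def by (intro eq_zero_if_quad_coords_zero[OF q]) auto
  qed
qed

lemma typeIII_space_dim:
  assumes "V \<in> typeIII"
  shows "vec.subspace V" "vec.dim V = 3"
proof -
  obtain a b c where "V = typeIII_space a b c" using assms unfolding typeIII_iff by blast
  then show sub: "vec.subspace V"
    by (auto simp: typeIII_space_def coord_linear intro!: vec.subspaceI)
  obtain i j k i' j' k' :: 6 where V: "V = {l. l $ i' = 0 \<and> l $ j' = 0 \<and> l $ k' = 0}"
    and idx: "distinct [i, j, k, i', j', k']"
  proof -
    note th = that
    show thesis
      using assms unfolding typeIII_eq typeIII_space_def coord_simps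
      using th[of 1 2 4 3 5 6] th[of 1 3 5 2 4 6] th[of 2 3 6 1 4 5] th[of 4 5 6 1 2 3]
        th[of 3 5 6 1 2 4] th[of 2 4 6 1 3 5] th[of 1 4 5 2 3 6] th[of 1 2 3 4 5 6] by auto
  qed
  show "vec.dim V = 3"
  proof (rule vec_dim_eq_3I[OF sub, of i j k])
    fix x y z
    show "\<exists>l\<in>V. l $ i = x \<and> l $ j = y \<and> l $ k = z"
      by (rule bexI[of _ "\<chi> m. if m = i then x else if m = j then y else if m = k then z else 0"])
        (use idx in \<open>auto simp: V\<close>)
  next
    fix l assume "l \<in> V" "l $ i = 0" "l $ j = 0" "l $ k = 0"
    then have "l $ m = 0" for m using distinct_6_UNIV[OF idx, of m] by (auto simp: V)
    then show "l = 0" by (simp add: vec_eq_iff)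
  qed
qed

section \<open>Counting the subspaces\<close>

lemma card_signs: "card signs = 2"
  by (simp add: signs_def)

lemma card_typeI: "card typeI = 32"
proof -
  have "inj_on (\<lambda>(s13, s23, s14, s24, s34). typeI_space s13 s23 s14 s24 s34) (signs \<times> signs \<times> signs \<times> signs \<times> signs)"
  proof (rule inj_onI)
    fix x x' assume *: "x \<in> signs \<times> signs \<times> signs \<times> signs \<times> signs" "x' \<in> signs \<times> signs \<times> signs \<times> signs \<times> signs"
      "(\<lambda>(s13, s23, s14, s24, s34). typeI_space s13 s23 s14 s24 s34) x
        = (\<lambda>(s13, s23, s14, s24, s34). typeI_space s13 s23 s14 s24 s34) x'"
    obtain s13 s23 s14 s24 s34 t13 t23 t14 t24 t34
      where x: "x = (s13, s23, s14, s24, s34)" "x' = (t13, t23, t14, t24, t34)"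
      by (metis surj_pair)
    have s: "s13 \<in> signs" "s23 \<in> signs" "s14 \<in> signs" "s24 \<in> signs" "s34 \<in> signs"
      and t: "t13 \<in> signs" "t23 \<in> signs" "t14 \<in> signs" "t24 \<in> signs" "t34 \<in> signs"
      and eq: "typeI_space s13 s23 s14 s24 s34 = typeI_space t13 t23 t14 t24 t34"
      using * unfolding x by auto
    \<comment> \<open>Lengths of the collinear points 0, 1, 3, 7, whose pairwise distances are distinct.\<close>
    have "vec6 (- 1) (- 3 * s13) (- 7 * s14) (- 2 * s23) (- 6 * s24) (- 4 * s34) \<in> typeI_space s13 s23 s14 s24 s34"
      using s by (auto simp: typeI_space_def signs_def)
    then have "vec6 (- 1) (- 3 * s13) (- 7 * s14) (- 2 * s23) (- 6 * s24) (- 4 * s34) \<in> typeI_space t13 t23 t14 t24 t34"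
      using eq by simp
    then have "- 1 - t13 * (- 3 * s13) + t23 * (- 2 * s23) = 0" "- 1 - t14 * (- 7 * s14) + t24 * (- 6 * s24) = 0"
      "t13 * (- 3 * s13) - t14 * (- 7 * s14) + t34 * (- 4 * s34) = 0"
      unfolding typeI_space_def mem_Collect_eq vec6_nth by blast+
    then have "- 1 + 3 * (t13 * s13) - 2 * (t23 * s23) = 0" "- 1 + 7 * (t14 * s14) - 6 * (t24 * s24) = 0"
      "- 3 * (t13 * s13) + 7 * (t14 * s14) - 4 * (t34 * s34) = 0"
      by (simp_all add: mult.left_commute)
    note e = this
    have prod: "t13 * s13 \<in> signs" "t23 * s23 \<in> signs" "t14 * s14 \<in> signs" "t24 * s24 \<in> signs" "t34 * s34 \<in> signs"
      using s t by (simp_all add: signs_mult)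
    \<comment> \<open>For signs x and y, 3 x - 2 y = 1 has only the solution x = y = 1; the same
      holds for 7 x - 6 y = 1.\<close>
    have e1: "t13 * s13 = 1" "t23 * s23 = 1" using e(1) prod(1,2) unfolding signs_def by auto
    have e2: "t14 * s14 = 1" "t24 * s24 = 1" using e(2) prod(3,4) unfolding signs_def by auto
    have "t34 * s34 = 1" using e(3) unfolding e1 e2 by simp
    note e1 e2 this
    moreover have "s = t" if "s \<in> signs" "t \<in> signs" "t * s = 1" for s t
      using that by (auto simp: signs_def)
    ultimately show "x = x'" unfolding x using s t by blast
  qed
  then show ?thesis unfolding typeI_eq by (simp add: card_image card_cartesian_product card_signs)
qed

lemma edge_quads_eqI:
  assumes "(a, b, c, e) \<in> edge_quads" "(a', b', c', e') \<in> edge_quads" "edge_idx a b = edge_idx a' b'"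
  shows "(a, b, c, e) = (a', b', c', e')"
  using assms unfolding edge_quads_def by (auto simp: edge_idx_def)

lemma quad_point_zero_coord:
  assumes "(a, b, c, e) \<in> edge_quads" "u \<noteq> 0" "v \<noteq> 0" "w \<noteq> 0" "x \<noteq> 0" "y \<noteq> 0"
    "quad_point a b c e u v w x y $ i = 0"
  shows "i = edge_idx a b"
  using assms(2-) unfolding quad_point_def by (auto split: if_splits)

lemma card_typeII: "card typeII = 24"
proof -
  have "inj_on (\<lambda>((a, b, c, e), s, t). typeII_space a b c e s t) (edge_quads \<times> signs \<times> signs)"
  proof (rule inj_onI)
    fix x x' assume *: "x \<in> edge_quads \<times> signs \<times> signs" "x' \<in> edge_quads \<times> signs \<times> signs"
      "(\<lambda>((a, b, c, e), s, t). typeII_space a b c e s t) x = (\<lambda>((a, b, c, e), s, t). typeII_space a b c e s t) x'"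
    obtain a b c e s t a' b' c' e' s' t' where x: "x = ((a, b, c, e), s, t)" "x' = ((a', b', c', e'), s', t')"
      by (metis surj_pair)
    have q: "(a, b, c, e) \<in> edge_quads" "(a', b', c', e') \<in> edge_quads"
      and st: "s \<in> signs" "t \<in> signs" "s' \<in> signs" "t' \<in> signs"
      and eq: "typeII_space a b c e s t = typeII_space a' b' c' e' s' t'"
      using * unfolding x by auto
    \<comment> \<open>A point whose only zero coordinate is the edge ab: the zero recovers the edge,
      and the values \<open>s\<close> and \<open>t\<close> recover the signs.\<close>
    define l where "l = quad_point a b c e s 1 t 1 1"
    note l_coords = quad_point_coords[OF q(1), of s 1 t 1 1, folded l_def]
    have "l \<in> typeII_space a b c e s t" by (simp add: typeII_space_def l_coords)
    then have l: "l \<in> typeII_space a' b' c' e' s' t'" using eq by simp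
    have "edge_idx a' b' = edge_idx a b"
      by (rule quad_point_zero_coord[OF q(1), of s 1 t 1 1])
        (use l st in \<open>auto simp: typeII_space_def signs_def coord_def l_def\<close>)
    then have "(a, b, c, e) = (a', b', c', e')" using edge_quads_eqI q by metis
    moreover from this have "s = s'" "t = t'" using l l_coords by (auto simp: typeII_space_def)
    ultimately show "x = x'" unfolding x by simp
  qed
  moreover have "card edge_quads = 6" by (simp add: edge_quads_def)
  ultimately show ?thesis unfolding typeII_eq by (simp add: card_image card_cartesian_product card_signs)
qed

lemma card_typeIII: "card typeIII = 4"
proof -
  have "vec6 0 0 1 0 1 1 \<in> typeIII_space 1 2 3" "vec6 0 1 0 1 0 1 \<in> typeIII_space 1 2 4"
    "vec6 1 0 0 1 1 0 \<in> typeIII_space 1 3 4" "vec6 1 1 1 0 0 0 \<in> typeIII_space 2 3 4"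
    by (simp_all add: typeIII_space_def coord_simps_Suc)
  moreover have "vec6 0 0 1 0 1 1 \<notin> typeIII_space 1 2 4" "vec6 0 0 1 0 1 1 \<notin> typeIII_space 1 3 4"
    "vec6 0 0 1 0 1 1 \<notin> typeIII_space 2 3 4" "vec6 0 1 0 1 0 1 \<notin> typeIII_space 1 3 4"
    "vec6 0 1 0 1 0 1 \<notin> typeIII_space 2 3 4" "vec6 1 0 0 1 1 0 \<notin> typeIII_space 2 3 4"
    by (simp_all add: typeIII_space_def coord_simps_Suc)
  ultimately have "distinct [typeIII_space 1 2 3, typeIII_space 1 2 4, typeIII_space 1 3 4, typeIII_space 2 3 4]"
    unfolding distinct.simps list.set by blast
  from distinct_card[OF this] show ?thesis unfolding typeIII_eq by simp
qed

text \<open>The types differ in how many coordinates vanish identically on a space: none for type I,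
  one for type II, three for type III.\<close>

lemma typeI_disjoint: "typeI \<inter> (typeII \<union> typeIII) = {}"
proof -
  have "\<exists>l\<in>V. \<forall>i. l $ i \<noteq> 0" if "V \<in> typeI" for V
  proof -
    obtain s13 s23 s14 s24 s34 where s: "s13 \<in> signs" "s23 \<in> signs" "s14 \<in> signs" "s24 \<in> signs" "s34 \<in> signs"
      and V: "V = typeI_space s13 s23 s14 s24 s34" using \<open>V \<in> typeI\<close> unfolding typeI_eq by auto
    let ?l = "vec6 (- 1) (- 3 * s13) (- 7 * s14) (- 2 * s23) (- 6 * s24) (- 4 * s34)"
    have "?l \<in> V" unfolding V using s by (auto simp: typeI_space_def signs_def)
    moreover have "\<forall>i. ?l $ i \<noteq> 0" unfolding forall_6 using s by (auto simp: signs_def)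
    ultimately show ?thesis by blast
  qed
  moreover have "\<exists>i. \<forall>l\<in>V. l $ i = 0" if "V \<in> typeII \<union> typeIII" for V
    using that unfolding Un_iff typeII_iff typeIII_iff typeII_space_def typeIII_space_def coord_def by blast
  ultimately show ?thesis by blast
qed

lemma typeII_typeIII_disjoint: "typeII \<inter> typeIII = {}"
proof -
  have "\<exists>l\<in>V. \<exists>i. \<forall>j. l $ j = 0 \<longrightarrow> j = i" if "V \<in> typeII" for V
  proof -
    obtain a b c e s t where q: "(a, b, c, e) \<in> edge_quads" and st: "s \<in> signs" "t \<in> signs"
      and V: "V = typeII_space a b c e s t" using \<open>V \<in> typeII\<close> unfolding typeII_eq by auto
    have "quad_point a b c e s 1 t 1 1 \<in> V"
      by (simp add: V typeII_space_def quad_point_coords[OF q])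
    moreover have "\<forall>j. quad_point a b c e s 1 t 1 1 $ j = 0 \<longrightarrow> j = edge_idx a b"
      using quad_point_zero_coord[OF q, of s 1 t 1 1] st by (auto simp: signs_def)
    ultimately show ?thesis by blast
  qed
  moreover have "\<exists>i j. i \<noteq> j \<and> (\<forall>l\<in>V. l $ i = 0 \<and> l $ j = 0)" if "V \<in> typeIII" for V
  proof -
    have "\<exists>i j. i \<noteq> j \<and> (\<forall>l\<in>{l :: complex ^ 6. l $ a = 0 \<and> l $ b = 0 \<and> l $ c = 0}. l $ i = 0 \<and> l $ j = 0)"
      if "a \<noteq> b" for a b c using that by blast
    then show ?thesis using that unfolding typeIII_eq typeIII_space_def coord_simps by auto
  qed
  ultimately show ?thesis by (metis disjoint_iff)
qed

theorem theorem5p17: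
  shows "sing L24 = \<Union>(typeI \<union> typeII \<union> typeIII)
    \<and> card typeI = 32 \<and> card typeII = 24 \<and> card typeIII = 4
    \<and> card (typeI \<union> typeII \<union> typeIII) = 60
    \<and> (\<forall>V \<in> typeI \<union> typeII \<union> typeIII. vec.subspace V \<and> vec.dim V = 3)
    \<and> \<Union>typeI = L14"
proof (intro conjI)
  show "sing L24 = \<Union>(typeI \<union> typeII \<union> typeIII)"
    unfolding sing_L24_critical Union_types_eq_critical ..
  show "card typeI = 32" "card typeII = 24" "card typeIII = 4" "\<Union>typeI = L14"
    by (rule card_typeI card_typeII card_typeIII Union_typeI)+
  have fin: "finite typeI" "finite typeII" "finite typeIII"
    using card_typeI card_typeII card_typeIII by (auto intro: card_ge_0_finite)
  have "card (typeI \<union> (typeII \<union> typeIII)) = card typeI + (card typeII + card typeIII)"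
    using fin typeI_disjoint typeII_typeIII_disjoint by (simp add: card_Un_disjoint)
  then show "card (typeI \<union> typeII \<union> typeIII) = 60"
    by (simp add: card_typeI card_typeII card_typeIII Un_assoc)
  have "vec.subspace V \<and> vec.dim V = 3" if "V \<in> typeI" for V
    using that typeI_space_dim unfolding typeI_eq by auto
  moreover have "vec.subspace V \<and> vec.dim V = 3" if "V \<in> typeII" for V
    using that typeII_space_dim unfolding typeII_eq by auto
  ultimately show "\<forall>V \<in> typeI \<union> typeII \<union> typeIII. vec.subspace V \<and> vec.dim V = 3"
    using typeIII_space_dim by blast
qed

end
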